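(* Let $K$ be a locally finite CAT(0) square $2$-complex. Then $K$ has an arborescent structure, i.e. $K$ is a monotone union $K=\bigcup_{n=1}^{\infty} L_n$ (with $L_n\subseteq L_{n+1}$ for all $n$) of a sequence of collapsible subcomplexes $L_n$.
   Context: A cubical complex is a complex obtained from a disjoint union of unit Euclidean cubes $[0,1]^{n_\lambda}$ by gluing faces by isometries, such that each cube injects into the complex and the intersection of any two cells is empty or a single face. A square ($2$-)complex is a $2$-dimensional cubical complex. Its underlying space $|K|$ carries the length metric in which every cell is isometric to a unit cube; $K$ is CAT(0) if $|K|$ with this metric is a CAT(0) space. $K$ is locally finite if every point has a neighborhood meeting only finitely many cells. Elementary collapse: if $\alpha$ is an $i$-cell of a complex $L$ and $\beta$ is a $k$-dimensional face of $\alpha$, $k<i$, that is not a (proper) face of any other cell of $L$, then there is an elementary collapse from $L$ to $L\setminus\{\alpha,\beta\}$. A complex is collapsible if it can be reduced to a single vertex by a finite sequence of elementary collapses. *)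

theory Defs
  imports "HOL-Analysis.Analysis"
begin

section \<open>CAT(0) metric spaces\<close>

definition geodesic :: "'a set \<Rightarrow> ('a \<Rightarrow> 'a \<Rightarrow> real) \<Rightarrow> 'a \<Rightarrow> 'a \<Rightarrow> (real \<Rightarrow> 'a) \<Rightarrow> bool" where
  "geodesic M d x y c \<longleftrightarrow>
     c ` {0..d x y} \<subseteq> M \<and> c 0 = x \<and> c (d x y) = y \<and>
     (\<forall>s\<in>{0..d x y}. \<forall>t\<in>{0..d x y}. d (c s) (c t) = \<bar>s - t\<bar>)"

definition geodesic_space :: "'a set \<Rightarrow> ('a \<Rightarrow> 'a \<Rightarrow> real) \<Rightarrow> bool" where
  "geodesic_space M d \<longleftrightarrow> Metric_space M d \<and> (\<forall>x\<in>M. \<forall>y\<in>M. \<exists>c. geodesic M d x y c)"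

text \<open>\<open>z'\<close> is the comparison point, on the Euclidean segment from \<open>x'\<close> to \<open>y'\<close>, of the point
  \<open>z\<close> of the geodesic \<open>c\<close> from \<open>x\<close> to \<open>y\<close>.\<close>

definition comparison_point ::
  "('a \<Rightarrow> 'a \<Rightarrow> real) \<Rightarrow> 'a \<Rightarrow> 'a \<Rightarrow> (real \<Rightarrow> 'a) \<Rightarrow> real^2 \<Rightarrow> real^2 \<Rightarrow> 'a \<Rightarrow> real^2 \<Rightarrow> bool" where
  "comparison_point d x y c x' y' z z' \<longleftrightarrow>
     (\<exists>t\<in>{0..d x y}. z = c t \<and> z' \<in> closed_segment x' y' \<and> dist x' z' = t)"

definition CAT0_space :: "'a set \<Rightarrow> ('a \<Rightarrow> 'a \<Rightarrow> real) \<Rightarrow> bool" where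
  "CAT0_space M d \<longleftrightarrow> geodesic_space M d \<and>
     (\<forall>p\<in>M. \<forall>q\<in>M. \<forall>r\<in>M. \<forall>a b c. \<forall>p' q' r' :: real^2.
        geodesic M d p q a \<and> geodesic M d q r b \<and> geodesic M d r p c \<and>
        dist p' q' = d p q \<and> dist q' r' = d q r \<and> dist r' p' = d r p \<longrightarrow>
        (let corr = (\<lambda>z z'. comparison_point d p q a p' q' z z' \<or>
                            comparison_point d q r b q' r' z z' \<or>
                            comparison_point d r p c r' p' z z')
         in \<forall>z z' w w'. corr z z' \<and> corr w w' \<longrightarrow> d z w \<le> dist z' w'))"

section \<open>Unit cubes and their faces\<close>

text \<open>Points of \<open>\<real>\<^sup>n\<close> are functions vanishing at all indices \<open>\<ge> n\<close>, so that cubes of different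
  dimensions live in one type.\<close>

definition unit_cube :: "nat \<Rightarrow> (nat \<Rightarrow> real) set" where
  "unit_cube n = {x. (\<forall>i<n. 0 \<le> x i \<and> x i \<le> 1) \<and> (\<forall>i\<ge>n. x i = 0)}"

definition eucl_dist :: "nat \<Rightarrow> (nat \<Rightarrow> real) \<Rightarrow> (nat \<Rightarrow> real) \<Rightarrow> real" where
  "eucl_dist n x y = L2_set (\<lambda>i. x i - y i) {..<n}"

text \<open>The nonempty faces of \<open>[0,1]\<^sup>n\<close> (the cube itself included): the coordinates in \<open>S\<close> are fixed
  to \<open>0\<close>, those in \<open>T\<close> to \<open>1\<close>, and the \<open>k\<close> others are free.\<close>

definition cube_face :: "nat \<Rightarrow> nat \<Rightarrow> (nat \<Rightarrow> real) set \<Rightarrow> bool" where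
  "cube_face n k F \<longleftrightarrow>
     (\<exists>S T. S \<inter> T = {} \<and> S \<union> T \<subseteq> {..<n} \<and> k = n - card (S \<union> T) \<and>
        F = {x \<in> unit_cube n. (\<forall>i\<in>S. x i = 0) \<and> (\<forall>i\<in>T. x i = 1)})"

section \<open>Cubical complexes\<close>

text \<open>A complex is presented by its cubes, indexed by \<open>Cubes K\<close>, and by the restrictions
  \<open>chart K l\<close> to the individual cubes of the quotient map from their disjoint union onto the
  underlying space. Every quotient of a disjoint union of cubes has this form.\<close>

record ('i, 'a) cubes =
  Cubes :: "'i set"
  cdim  :: "'i \<Rightarrow> nat"
  chart :: "'i \<Rightarrow> (nat \<Rightarrow> real) \<Rightarrow> 'a"

definition cube_of :: "('i, 'a) cubes \<Rightarrow> 'i \<Rightarrow> (nat \<Rightarrow> real) set" where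
  "cube_of K l = unit_cube (cdim K l)"

definition underlying :: "('i, 'a) cubes \<Rightarrow> 'a set" where
  "underlying K = (\<Union>l\<in>Cubes K. chart K l ` cube_of K l)"

text \<open>Each cube injects, and two cubes that meet are identified exactly along one face of each, by
  an isometry \<open>h\<close> between these faces.\<close>

definition cubical_complex :: "('i, 'a) cubes \<Rightarrow> bool" where
  "cubical_complex K \<longleftrightarrow>
     (\<forall>l\<in>Cubes K. inj_on (chart K l) (cube_of K l)) \<and>
     (\<forall>l\<in>Cubes K. \<forall>m\<in>Cubes K.
        chart K l ` cube_of K l \<inter> chart K m ` cube_of K m \<noteq> {} \<longrightarrow>
        (\<exists>j k F G h. cube_face (cdim K l) j F \<and> cube_face (cdim K m) k G \<and> bij_betw h F G \<and>
           (\<forall>x\<in>F. \<forall>y\<in>F. eucl_dist (cdim K m) (h x) (h y) = eucl_dist (cdim K l) x y) \<and>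
           (\<forall>x\<in>cube_of K l. \<forall>y\<in>cube_of K m.
              chart K l x = chart K m y \<longleftrightarrow> x \<in> F \<and> y = h x)))"

definition is_cell :: "('i, 'a) cubes \<Rightarrow> nat \<Rightarrow> 'a set \<Rightarrow> bool" where
  "is_cell K k \<alpha> \<longleftrightarrow> (\<exists>l\<in>Cubes K. \<exists>F. cube_face (cdim K l) k F \<and> \<alpha> = chart K l ` F)"

definition cells :: "('i, 'a) cubes \<Rightarrow> 'a set set" where
  "cells K = {\<alpha>. \<exists>k. is_cell K k \<alpha>}"

definition cell_face :: "('i, 'a) cubes \<Rightarrow> 'a set \<Rightarrow> 'a set \<Rightarrow> bool" where
  "cell_face K \<beta> \<alpha> \<longleftrightarrow>
     (\<exists>l\<in>Cubes K. \<exists>j k F G. cube_face (cdim K l) j G \<and> cube_face (cdim K l) k F \<and> G \<subseteq> F \<and>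
        \<beta> = chart K l ` G \<and> \<alpha> = chart K l ` F)"

definition complex_dim :: "('i, 'a) cubes \<Rightarrow> nat \<Rightarrow> bool" where
  "complex_dim K n \<longleftrightarrow> (\<forall>k \<alpha>. is_cell K k \<alpha> \<longrightarrow> k \<le> n) \<and> (\<exists>\<alpha>. is_cell K n \<alpha>)"

definition square_complex :: "('i, 'a) cubes \<Rightarrow> bool" where
  "square_complex K \<longleftrightarrow> cubical_complex K \<and> complex_dim K 2"

section \<open>The length metric\<close>

text \<open>\<open>polygonal_path K x y r\<close>: a path made of finitely many straight segments, each inside one cube,
  leads from \<open>x\<close> to \<open>y\<close> and has length \<open>r\<close>. Replacing the pieces of a path by chords does not
  lengthen it, so the infimum over these paths is the length metric.\<close>

inductive polygonal_path :: "('i, 'a) cubes \<Rightarrow> 'a \<Rightarrow> 'a \<Rightarrow> real \<Rightarrow> bool" for K where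
  point: "x \<in> underlying K \<Longrightarrow> polygonal_path K x x 0"
| segment: "\<lbrakk>l \<in> Cubes K; u \<in> cube_of K l; v \<in> cube_of K l; polygonal_path K (chart K l v) y r\<rbrakk>
     \<Longrightarrow> polygonal_path K (chart K l u) y (eucl_dist (cdim K l) u v + r)"

text \<open>The distance is \<open>\<infinity>\<close> between different path components.\<close>

definition length_edist :: "('i, 'a) cubes \<Rightarrow> 'a \<Rightarrow> 'a \<Rightarrow> ereal" where
  "length_edist K x y = (INF r\<in>{r. polygonal_path K x y r}. ereal r)"

definition length_dist :: "('i, 'a) cubes \<Rightarrow> 'a \<Rightarrow> 'a \<Rightarrow> real" where
  "length_dist K x y = real_of_ereal (length_edist K x y)"

text \<open>The finiteness condition is needed because \<open>real_of_ereal \<infinity> = 0\<close>.\<close>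

definition CAT0_complex :: "('i, 'a) cubes \<Rightarrow> bool" where
  "CAT0_complex K \<longleftrightarrow>
     (\<forall>x\<in>underlying K. \<forall>y\<in>underlying K. length_edist K x y < \<infinity>) \<and>
     CAT0_space (underlying K) (length_dist K)"

definition locally_finite_complex :: "('i, 'a) cubes \<Rightarrow> bool" where
  "locally_finite_complex K \<longleftrightarrow>
     (\<forall>x\<in>underlying K. \<exists>r>0.
        finite {\<alpha> \<in> cells K. \<alpha> \<inter> {y \<in> underlying K. length_edist K x y < ereal r} \<noteq> {}})"

section \<open>Subcomplexes and collapses\<close>

definition subcomplex :: "('i, 'a) cubes \<Rightarrow> 'a set set \<Rightarrow> bool" where
  "subcomplex K L \<longleftrightarrow> L \<subseteq> cells K \<and> (\<forall>\<alpha>\<in>L. \<forall>\<beta>. cell_face K \<beta> \<alpha> \<longrightarrow> \<beta> \<in> L)"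

definition elementary_collapse :: "('i, 'a) cubes \<Rightarrow> 'a set set \<Rightarrow> 'a set set \<Rightarrow> bool" where
  "elementary_collapse K L L' \<longleftrightarrow> subcomplex K L \<and>
     (\<exists>\<alpha>\<in>L. \<exists>\<beta>\<in>L. \<exists>i k. is_cell K i \<alpha> \<and> is_cell K k \<beta> \<and> k < i \<and> cell_face K \<beta> \<alpha> \<and>
        (\<forall>\<gamma>\<in>L. cell_face K \<beta> \<gamma> \<and> \<gamma> \<noteq> \<beta> \<longrightarrow> \<gamma> = \<alpha>) \<and>
        L' = L - {\<alpha>, \<beta>})"

definition collapsible :: "('i, 'a) cubes \<Rightarrow> 'a set set \<Rightarrow> bool" where
  "collapsible K L \<longleftrightarrow> subcomplex K L \<and>
     (\<exists>v. is_cell K 0 v \<and> (elementary_collapse K)\<^sup>*\<^sup>* L {v})"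

definition arborescent_structure :: "('i, 'a) cubes \<Rightarrow> (nat \<Rightarrow> 'a set set) \<Rightarrow> bool" where
  "arborescent_structure K L \<longleftrightarrow>
     (\<forall>n\<ge>1. subcomplex K (L n) \<and> collapsible K (L n) \<and> L n \<subseteq> L (Suc n)) \<and>
     cells K = (\<Union>n\<in>{1..}. L n)"

end

theory Submission
  imports Defs
begin

text \<open>Fix a vertex \<open>v\<close> and let \<open>f = d(\<cdot>, v)\<close>. At a vertex \<open>w \<noteq> v\<close>, an edge along which \<open>f\<close> does not
  increase makes an angle of less than \<open>\<pi>/2\<close> with the geodesic from \<open>w\<close> to \<open>v\<close>. The edges at \<open>w\<close>
  are pairwise at angle at least \<open>\<pi>/2\<close>, so all such edges lie in the one cube that this geodesic
  enters first. Hence there are at most two of them, there is at least one, and if there are two, then \<open>f\<close> is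
  smaller than \<open>f w\<close> at the opposite corner of the square that they span. Therefore the descending
  link of \<open>w\<close> is a point or an edge, and the full subcomplex spanned by the finitely many vertices
  with \<open>f \<le> n\<close> collapses to \<open>v\<close> by removing its vertices in the order of decreasing \<open>f\<close>.
  Local lower bounds for the length metric come from functions that are 1-Lipschitz on each cube.\<close>

section \<open>Euclidean cubes\<close>

text \<open>Angles are never defined. The geodesic from \<open>w\<close> is followed up to a time
  \<open>t < 1\<close> and an edge up to a small parameter \<open>s\<close>, and two estimates of
  the distance between the two points compete. With \<open>D = d w v\<close>, the comparison
  triangle bounds its square by \<open>t\<^sup>2 + s\<^sup>2 - t * s / D\<close>. If the edge left
  the cube of the geodesic point, the square could not fall below
  \<open>t\<^sup>2 + s\<^sup>2\<close>, as when one passes from the geodesic to the edge at a right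
  angle. Ties shape the rest. Several vertices may be equally far from \<open>v\<close> and are
  removed one at a time, so edges along which the distance is merely non-increasing must be
  controlled. The set of remaining vertices, however, is only known to be closed under strictly
  smaller distance. Hence some neighbour and, if there are two such edges, the opposite corner must
  be strictly nearer to \<open>v\<close>. The term \<open>t * s / D\<close>, with \<open>t\<close>
  close to 1, supplies this strictness for the corner.\<close>

lemma eucl_dist_power2: "(eucl_dist n x y)\<^sup>2 = (\<Sum>i<n. (x i - y i)\<^sup>2)"
  by (simp add: eucl_dist_def L2_set_def sum_nonneg)

lemma eucl_dist_nonneg [simp]: "0 \<le> eucl_dist n x y"
  by (simp add: eucl_dist_def L2_set_nonneg)

lemma eucl_dist_commute: "eucl_dist n x y = eucl_dist n y x"
  by (simp add: eucl_dist_def L2_set_def power2_commute)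

lemma eucl_dist_triangle: "eucl_dist n x z \<le> eucl_dist n x y + eucl_dist n y z"
  using L2_set_triangle_ineq[of "\<lambda>i. x i - y i" "\<lambda>i. y i - z i" "{..<n}"]
  by (simp add: eucl_dist_def)

lemma eucl_dist_eq_0: "eucl_dist n x y = 0 \<longleftrightarrow> (\<forall>i<n. x i = y i)"
  by (auto simp: eucl_dist_def L2_set_eq_0_iff)

lemma coord_le_eucl_dist:
  assumes "i < n"
  shows "\<bar>x i - y i\<bar> \<le> eucl_dist n x y"
proof -
  have "(x i - y i)\<^sup>2 \<le> (\<Sum>i<n. (x i - y i)\<^sup>2)"
    using assms by (intro member_le_sum) auto
  then show ?thesis
    by (metis abs_le_square_iff abs_of_nonneg eucl_dist_nonneg eucl_dist_power2)
qed

text \<open>Stewart's theorem, a quadratic identity in each coordinate. It computes the distance to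
  a point of an edge from the distances to its two ends.\<close>

lemma stewart:
  assumes "\<And>i. i < n \<Longrightarrow> z i = (1 - s) * x i + s * y i"
  shows "(eucl_dist n q z)\<^sup>2 =
    (1 - s) * (eucl_dist n q x)\<^sup>2 + s * (eucl_dist n q y)\<^sup>2 - s * (1 - s) * (eucl_dist n x y)\<^sup>2"
proof -
  have "(q i - z i)\<^sup>2 = (1 - s) * (q i - x i)\<^sup>2 + s * (q i - y i)\<^sup>2 - s * (1 - s) * (x i - y i)\<^sup>2"
    if "i < n" for i
    unfolding assms[OF that] by (simp add: power2_eq_square algebra_simps)
  then show ?thesis
    by (simp add: eucl_dist_power2 sum_distrib_left sum.distrib sum_subtractf)
qed

text \<open>Strict convexity: \<open>stewart\<close> with \<open>z\<close> as base point makes the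
  distance from \<open>z\<close> to the affine combination \<open>m\<close> vanish.\<close>

lemma between_unique:
  assumes "eucl_dist n x z = s * eucl_dist n x y" "eucl_dist n z y = (1 - s) * eucl_dist n x y" "i < n"
  shows "z i = (1 - s) * x i + s * y i"
proof -
  define m where "m i = (1 - s) * x i + s * y i" for i
  have "(eucl_dist n z m)\<^sup>2 = (1 - s) * (eucl_dist n z x)\<^sup>2 + s * (eucl_dist n z y)\<^sup>2
      - s * (1 - s) * (eucl_dist n x y)\<^sup>2"
    by (rule stewart) (simp add: m_def)
  also have "\<dots> = 0"
    unfolding eucl_dist_commute[of n z x] assms by (simp add: power2_eq_square algebra_simps)
  finally have "eucl_dist n z m = 0"
    by simp
  then show ?thesis
    using assms(3) by (simp add: eucl_dist_eq_0 m_def)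
qed

section \<open>Corners and faces of the unit cube\<close>

definition cube_vertices :: "nat \<Rightarrow> (nat \<Rightarrow> real) set" where
  "cube_vertices n = {x. (\<forall>i<n. x i = 0 \<or> x i = 1) \<and> (\<forall>i\<ge>n. x i = 0)}"

definition flip :: "nat \<Rightarrow> (nat \<Rightarrow> real) \<Rightarrow> nat \<Rightarrow> real" where
  "flip i x = x(i := 1 - x i)"

text \<open>\<open>J\<close> is the set of free directions and \<open>x\<close> any point of the
  face. With \<open>x\<close> a fixed corner, the faces through it are indexed by sets of
  directions.\<close>

definition subface :: "nat \<Rightarrow> nat set \<Rightarrow> (nat \<Rightarrow> real) \<Rightarrow> (nat \<Rightarrow> real) set" where
  "subface n J x = {z \<in> unit_cube n. \<forall>i. i \<notin> J \<longrightarrow> z i = x i}"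

lemma unit_cubeD: "x \<in> unit_cube n \<Longrightarrow> 0 \<le> x i" "x \<in> unit_cube n \<Longrightarrow> x i \<le> 1"
  "x \<in> unit_cube n \<Longrightarrow> n \<le> i \<Longrightarrow> x i = 0"
  by (cases "i < n"; force simp: unit_cube_def)+

lemma cube_vertices_subset: "cube_vertices n \<subseteq> unit_cube n"
  by (force simp: cube_vertices_def unit_cube_def)

lemma finite_cube_vertices: "finite (cube_vertices n)"
proof -
  have "cube_vertices n \<subseteq> (\<lambda>S i. if i \<in> S then 1 else 0) ` Pow {..<n}"
  proof
    fix x assume x: "x \<in> cube_vertices n"
    have "x = (\<lambda>i. if i \<in> {i. i < n \<and> x i = 1} then 1 else 0)"
    proof
      fix i show "x i = (if i \<in> {i. i < n \<and> x i = 1} then 1 else 0)"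
        using x by (cases "i < n") (auto simp: cube_vertices_def)
    qed
    then show "x \<in> (\<lambda>S i. if i \<in> S then 1 else 0) ` Pow {..<n}"
      by (intro image_eqI[of _ _ "{i. i < n \<and> x i = 1}"]) auto
  qed
  then show ?thesis
    by (rule finite_subset) simp
qed

lemma unit_cube_eqI: "x \<in> unit_cube n \<Longrightarrow> y \<in> unit_cube n \<Longrightarrow> (\<And>i. i < n \<Longrightarrow> x i = y i) \<Longrightarrow> x = y"
  by (rule ext) (metis linorder_not_le unit_cubeD(3))

lemma flip_apply: "flip i x j = (if j = i then 1 - x j else x j)"
  by (simp add: flip_def)

lemma cube_vertex_cases: "x \<in> cube_vertices n \<Longrightarrow> x i = 0 \<or> x i = 1"
  by (cases "i < n") (auto simp: cube_vertices_def)

lemma flip_vertex: "x \<in> cube_vertices n \<Longrightarrow> i < n \<Longrightarrow> flip i x \<in> cube_vertices n"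
  by (auto simp: cube_vertices_def flip_apply)

lemma flip_neq: "x \<in> cube_vertices n \<Longrightarrow> flip i x \<noteq> x"
  by (metis cube_vertex_cases diff_self diff_zero flip_apply zero_neq_one)

lemma flip_eq_iff: "x \<in> cube_vertices n \<Longrightarrow> flip i x = flip j x \<longleftrightarrow> i = j"
  by (metis cube_vertex_cases diff_self diff_zero flip_apply zero_neq_one)

text \<open>Only coordinate \<open>i\<close> changes: its contribution passes from
  \<open>r\<^sup>2\<close> to \<open>(1 - r)\<^sup>2\<close> for
  \<open>r = \<bar>z i - x i\<bar>\<close>. The flipped corner is nearer exactly when
  \<open>r > 1/2\<close>.\<close>

lemma eucl_dist_flip_sq:
  assumes "x \<in> cube_vertices n" "z \<in> unit_cube n" "i < n"
  shows "(eucl_dist n z (flip i x))\<^sup>2 = (eucl_dist n z x)\<^sup>2 + 1 - 2 * \<bar>z i - x i\<bar>"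
proof -
  have 1: "(z i - flip i x i)\<^sup>2 = (z i - x i)\<^sup>2 + 1 - 2 * \<bar>z i - x i\<bar>"
    using cube_vertex_cases[OF assms(1), of i] unit_cubeD(1,2)[OF assms(2), of i]
    by (auto simp: flip_apply power2_eq_square algebra_simps)
  have "(\<Sum>j\<in>{..<n}-{i}. (z j - flip i x j)\<^sup>2) = (\<Sum>j\<in>{..<n}-{i}. (z j - x j)\<^sup>2)"
    by (intro sum.cong) (auto simp: flip_apply)
  then show ?thesis
    using 1 assms(3) by (simp add: eucl_dist_power2 sum.remove[of "{..<n}" i])
qed

lemma eucl_dist_flip:
  assumes "x \<in> cube_vertices n" "i < n"
  shows "eucl_dist n x (flip i x) = 1"
proof -
  have "(eucl_dist n x (flip i x))\<^sup>2 = 1"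
    using eucl_dist_flip_sq[OF assms(1) _ assms(2), of x] assms cube_vertices_subset eucl_dist_power2[of n x x]
    by auto
  then show ?thesis
    by (simp add: power2_eq_1_iff) (metis eucl_dist_nonneg neg_0_le_iff_le not_one_le_zero)
qed

lemma cube_vertices_dist_ge_1:
  assumes "x \<in> cube_vertices n" "y \<in> cube_vertices n" "x \<noteq> y"
  shows "1 \<le> eucl_dist n x y"
proof -
  obtain i where i: "i < n" "x i \<noteq> y i"
    using assms cube_vertices_subset unit_cube_eqI by (metis subsetD)
  then have "\<bar>x i - y i\<bar> = 1"
    using cube_vertex_cases[OF assms(1), of i] cube_vertex_cases[OF assms(2), of i] by auto
  then show ?thesis
    using coord_le_eucl_dist[OF i(1), of x y] by simp
qed

text \<open>Flipping one coordinate in which the corners differ lowers the squared distance by 1,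
  hence to 0.\<close>

lemma cube_vertices_dist_1:
  assumes "x \<in> cube_vertices n" "y \<in> cube_vertices n" "eucl_dist n x y = 1"
  obtains i where "i < n" "y = flip i x"
proof -
  obtain i where i: "i < n" "x i \<noteq> y i"
    using assms(3) by (metis eucl_dist_eq_0 zero_neq_one)
  then have *: "\<bar>y i - x i\<bar> = 1"
    using cube_vertex_cases[OF assms(1), of i] cube_vertex_cases[OF assms(2), of i] by auto
  have "(eucl_dist n y (flip i x))\<^sup>2 = 0"
    using eucl_dist_flip_sq[OF assms(1) _ i(1), of y] assms cube_vertices_subset *
    by (auto simp: eucl_dist_commute[of n y x])
  then have "y = flip i x"
    using flip_vertex[OF assms(1) i(1)] assms(2) cube_vertices_subset
    by (intro unit_cube_eqI[of y n]) (auto simp: eucl_dist_eq_0)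
  then show ?thesis
    using i that by blast
qed

lemma cube_face_subface:
  assumes "x \<in> cube_vertices n" "J \<subseteq> {..<n}"
  shows "cube_face n (card J) (subface n J x)"
  unfolding cube_face_def
proof (intro exI conjI)
  let ?S = "{i. i < n \<and> i \<notin> J \<and> x i = 0}" and ?T = "{i. i < n \<and> i \<notin> J \<and> x i = 1}"
  show "?S \<inter> ?T = {}" "?S \<union> ?T \<subseteq> {..<n}"
    by auto
  have "?S \<union> ?T = {..<n} - J"
    using cube_vertex_cases[OF assms(1)] by auto
  then have "card (?S \<union> ?T) = n - card J"
    using assms(2) by (simp add: card_Diff_subset finite_subset)
  moreover have "card J \<le> n"
    using assms(2) by (metis card_lessThan card_mono finite_lessThan)
  ultimately show "card J = n - card (?S \<union> ?T)"
    by simp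
  show "subface n J x = {z \<in> unit_cube n. (\<forall>i\<in>?S. z i = 0) \<and> (\<forall>i\<in>?T. z i = 1)}"
  proof (intro set_eqI iffI)
    fix z assume z: "z \<in> {z \<in> unit_cube n. (\<forall>i\<in>?S. z i = 0) \<and> (\<forall>i\<in>?T. z i = 1)}"
    have "z i = x i" if "i \<notin> J" for i
      using z cube_vertex_cases[OF assms(1), of i] that unit_cubeD(3) assms(1) cube_vertices_subset
      by (cases "i < n") (auto, metis linorder_not_le subsetD)
    then show "z \<in> subface n J x"
      using z by (auto simp: subface_def)
  qed (auto simp: subface_def)
qed

lemma cube_faceE:
  assumes "cube_face n k F"
  obtains J where "J \<subseteq> {..<n}" "card J = k" "F \<subseteq> unit_cube n"
    "\<forall>x\<in>F. F = subface n J x" "\<forall>x\<in>F. \<forall>i. i \<notin> J \<longrightarrow> x i = 0 \<or> x i = 1"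
    "\<exists>x\<in>cube_vertices n. x \<in> F"
proof -
  obtain S T where ST: "S \<inter> T = {}" "S \<union> T \<subseteq> {..<n}" "k = n - card (S \<union> T)"
    "F = {x \<in> unit_cube n. (\<forall>i\<in>S. x i = 0) \<and> (\<forall>i\<in>T. x i = 1)}"
    using assms unfolding cube_face_def by blast
  let ?J = "{..<n} - (S \<union> T)"
  show ?thesis
  proof (rule that[of ?J])
    show "card ?J = k"
      using ST(3) card_Diff_subset[OF finite_subset[OF ST(2)] ST(2)] by simp
    show "F \<subseteq> unit_cube n"
      using ST by auto
    show "\<forall>x\<in>F. F = subface n ?J x"
      using ST(2) unfolding ST(4) subface_def by (auto simp: unit_cubeD(3))
    show "\<forall>x\<in>F. \<forall>i. i \<notin> ?J \<longrightarrow> x i = 0 \<or> x i = 1"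
      unfolding ST(4) by (auto simp: unit_cubeD(3))
    show "\<exists>x\<in>cube_vertices n. x \<in> F"
      using ST(1,2) unfolding ST(4)
      by (intro bexI[of _ "\<lambda>i. if i \<in> T then 1 else 0"]) (auto simp: cube_vertices_def unit_cube_def)
  qed auto
qed

section \<open>Gluing\<close>

locale cubical =
  fixes K :: "('i, 'a) cubes"
  assumes cubical: "cubical_complex K"
begin

abbreviation cell_of :: "'i \<Rightarrow> 'a set" where
  "cell_of l \<equiv> chart K l ` cube_of K l"

abbreviation ed :: "'i \<Rightarrow> (nat \<Rightarrow> real) \<Rightarrow> (nat \<Rightarrow> real) \<Rightarrow> real" where
  "ed l \<equiv> eucl_dist (cdim K l)"

abbreviation vert :: "'i \<Rightarrow> (nat \<Rightarrow> real) set" where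
  "vert l \<equiv> cube_vertices (cdim K l)"

abbreviation sub :: "'i \<Rightarrow> nat set \<Rightarrow> (nat \<Rightarrow> real) \<Rightarrow> (nat \<Rightarrow> real) set" where
  "sub l \<equiv> subface (cdim K l)"

lemma vert_cube: "x \<in> vert l \<Longrightarrow> x \<in> cube_of K l"
  using cube_vertices_subset by (auto simp: cube_of_def)

lemma chart_inj:
  "l \<in> Cubes K \<Longrightarrow> x \<in> cube_of K l \<Longrightarrow> y \<in> cube_of K l \<Longrightarrow> chart K l x = chart K l y \<longleftrightarrow> x = y"
  using cubical unfolding cubical_complex_def inj_on_def by blast

lemma glue:
  assumes "l \<in> Cubes K" "m \<in> Cubes K" "cell_of l \<inter> cell_of m \<noteq> {}"
  obtains j k F G h where "cube_face (cdim K l) j F" "cube_face (cdim K m) k G" "bij_betw h F G"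
    "\<forall>x\<in>F. \<forall>y\<in>F. ed m (h x) (h y) = ed l x y"
    "\<forall>x\<in>cube_of K l. \<forall>y\<in>cube_of K m. chart K l x = chart K m y \<longleftrightarrow> x \<in> F \<and> y = h x"
proof -
  note cubical[unfolded cubical_complex_def, THEN conjunct2, rule_format, OF assms]
  then show ?thesis
    by (elim exE conjE) (rule that)
qed

lemma glue_dist:
  assumes "l \<in> Cubes K" "m \<in> Cubes K"
    "x \<in> cube_of K l" "y \<in> cube_of K m" "chart K l x = chart K m y"
    "x' \<in> cube_of K l" "y' \<in> cube_of K m" "chart K l x' = chart K m y'"
  shows "ed l x x' = ed m y y'"
proof -
  have "cell_of l \<inter> cell_of m \<noteq> {}"
    using assms by (metis IntI empty_iff imageI)
  from glue[OF assms(1,2) this] show ?thesis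
    using assms(3-) by metis
qed

text \<open>The overlap with \<open>m\<close> is a face of \<open>l\<close>, given by its free
  directions \<open>J\<close> and the point \<open>x\<close>. Membership in the other cell thus
  becomes a test on the coordinates outside \<open>J\<close>.\<close>

lemma glue_face:
  assumes "l \<in> Cubes K" "m \<in> Cubes K" "x \<in> cube_of K l" "chart K l x \<in> cell_of m"
  obtains J where "J \<subseteq> {..<cdim K l}" "\<forall>i. i \<notin> J \<longrightarrow> x i = 0 \<or> x i = 1"
    "\<forall>z\<in>cube_of K l. chart K l z \<in> cell_of m \<longleftrightarrow> (\<forall>i. i \<notin> J \<longrightarrow> z i = x i)"
proof -
  have "cell_of l \<inter> cell_of m \<noteq> {}"
    using assms by blast
  then obtain j k F G h where g: "cube_face (cdim K l) j F" "cube_face (cdim K m) k G" "bij_betw h F G"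
    "\<forall>x\<in>F. \<forall>y\<in>F. ed m (h x) (h y) = ed l x y"
    "\<forall>x\<in>cube_of K l. \<forall>y\<in>cube_of K m. chart K l x = chart K m y \<longleftrightarrow> x \<in> F \<and> y = h x"
    by (rule glue[OF assms(1,2)])
  obtain J where J: "J \<subseteq> {..<cdim K l}" "card J = j" "F \<subseteq> unit_cube (cdim K l)"
    "\<forall>x\<in>F. F = sub l J x" "\<forall>x\<in>F. \<forall>i. i \<notin> J \<longrightarrow> x i = 0 \<or> x i = 1" "\<exists>x\<in>vert l. x \<in> F"
    by (rule cube_faceE[OF g(1)])
  have G: "G \<subseteq> cube_of K m"
    by (rule cube_faceE[OF g(2)]) (simp add: cube_of_def)
  have *: "chart K l z \<in> cell_of m \<longleftrightarrow> z \<in> F" if "z \<in> cube_of K l" for z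
  proof
    show "z \<in> F" if "chart K l z \<in> cell_of m"
      using g(5) that \<open>z \<in> cube_of K l\<close> by blast
    assume z: "z \<in> F"
    then have "h z \<in> cube_of K m"
      using g(3) G by (auto simp: bij_betw_def)
    then show "chart K l z \<in> cell_of m"
      using g(5) z that by (metis image_eqI)
  qed
  then have x: "x \<in> F"
    using assms by blast
  show ?thesis
  proof (rule that[OF J(1)])
    show "\<forall>i. i \<notin> J \<longrightarrow> x i = 0 \<or> x i = 1"
      using J(5) x by blast
    show "\<forall>z\<in>cube_of K l. chart K l z \<in> cell_of m \<longleftrightarrow> (\<forall>i. i \<notin> J \<longrightarrow> z i = x i)"
      using * J(4)[rule_format, OF x] by (simp add: subface_def cube_of_def set_eq_iff)
  qed
qed

text \<open>A corner is not the midpoint of a nontrivial segment in its cube. A point with a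
  coordinate strictly between 0 and 1 is one, for a segment inside the overlap, where the gluing is
  isometric. So being a vertex does not depend on the cube.\<close>

lemma glue_vertex:
  assumes "l \<in> Cubes K" "m \<in> Cubes K" "x \<in> vert l" "y \<in> cube_of K m" "chart K l x = chart K m y"
  shows "y \<in> vert m"
proof (rule ccontr)
  assume "y \<notin> vert m"
  then obtain i where i: "i < cdim K m" "y i \<noteq> 0" "y i \<noteq> 1"
    using assms(4) by (auto simp: cube_vertices_def cube_of_def unit_cube_def)
  have x: "x \<in> cube_of K l"
    using assms(3) by (rule vert_cube)
  \<comment> \<open>The largest half-length for which the segment in direction \<open>i\<close>
    centred at \<open>y\<close> stays in the cube.\<close>
  define e where "e = min (y i) (1 - y i)"
  have y01: "0 \<le> y i" "y i \<le> 1"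
    using assms(4) unit_cubeD(1,2) by (auto simp: cube_of_def)
  then have e: "0 < e" "e \<le> y i" "e \<le> 1 - y i"
    using i by (auto simp: e_def)
  have "chart K m y \<in> cell_of l"
    using assms(5) x by (metis image_eqI)
  then obtain J where J: "J \<subseteq> {..<cdim K m}" "\<forall>i. i \<notin> J \<longrightarrow> y i = 0 \<or> y i = 1"
    "\<forall>z\<in>cube_of K m. chart K m z \<in> cell_of l \<longleftrightarrow> (\<forall>i. i \<notin> J \<longrightarrow> z i = y i)"
    by (rule glue_face[OF assms(2,1,4)])
  have "i \<in> J"
    using J(2) i by blast
  define p where "p c = y(i := y i + c)" for c
  have p: "p c \<in> cube_of K m" if "\<bar>c\<bar> \<le> e" for c
    using assms(4) that e i by (auto simp: cube_of_def unit_cube_def p_def)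
  have ed_p: "ed m (p c) (p c') = \<bar>c - c'\<bar>" for c c'
  proof -
    have "(ed m (p c) (p c'))\<^sup>2 = \<bar>c - c'\<bar>\<^sup>2"
      using i(1) by (simp add: eucl_dist_power2 sum.remove[of "{..<cdim K m}" i] p_def)
    then show ?thesis
      by (rule power2_eq_imp_eq) simp_all
  qed
  have "\<exists>z\<in>cube_of K l. chart K l z = chart K m (p c)" if "\<bar>c\<bar> \<le> e" for c
    using J(3)[rule_format, OF p[OF that]] \<open>i \<in> J\<close> by (auto simp: p_def)
  then obtain q where q: "\<And>c. \<bar>c\<bar> \<le> e \<Longrightarrow> q c \<in> cube_of K l"
    "\<And>c. \<bar>c\<bar> \<le> e \<Longrightarrow> chart K l (q c) = chart K m (p c)"
    by metis
  have "p 0 = y"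
    by (simp add: p_def)
  then have "q 0 = x"
    using q[of 0] e(1) assms(5) chart_inj[OF assms(1) _ x] by auto
  have ed_q: "ed l (q c) (q c') = \<bar>c - c'\<bar>" if "\<bar>c\<bar> \<le> e" "\<bar>c'\<bar> \<le> e" for c c'
    using glue_dist[OF assms(1,2) q(1) p q(2) q(1) p q(2)] that ed_p by metis
  \<comment> \<open>Each coordinate of \<open>x\<close> is 0 or 1 and is the mean of two numbers in
    the unit interval, so both numbers equal it.\<close>
  have "q e j = x j" if "j < cdim K l" for j
  proof -
    have "q 0 j = (1 - 1/2) * q e j + 1/2 * q (-e) j"
      using that e(1) by (intro between_unique[of "cdim K l"]) (auto simp: ed_q)
    then show ?thesis
      using cube_vertex_cases[OF assms(3), of j] unit_cubeD(1,2)[of "q e" "cdim K l" j]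
        unit_cubeD(1,2)[of "q (-e)" "cdim K l" j] q(1)[of e] q(1)[of "-e"] e(1) \<open>q 0 = x\<close>
      by (auto simp: cube_of_def field_simps)
  qed
  then have "ed l (q e) (q 0) = 0"
    by (simp add: eucl_dist_eq_0 \<open>q 0 = x\<close>)
  then show False
    using ed_q[of e 0] e(1) by simp
qed

text \<open>The distances from a point \<open>z\<close> to \<open>p\<close> and to
  \<open>flip j p\<close> determine \<open>\<bar>z j - p j\<bar>\<close>, and gluing preserves
  distances. So the copy of \<open>z\<close> in \<open>l\<close> has the same offsets in the
  directions \<open>\<sigma> j\<close>; these already use up its whole distance from
  \<open>x\<close>, and it agrees with \<open>x\<close> in all other directions.\<close>

lemma face_transfer_aux:
  assumes l: "l \<in> Cubes K" and m: "m \<in> Cubes K" and x: "x \<in> vert l" and p: "p \<in> vert m"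
    and xp: "chart K l x = chart K m p" and J: "J \<subseteq> {..<cdim K m}"
    and \<sigma>: "\<And>j. j \<in> J \<Longrightarrow> \<sigma> j < cdim K l"
      "\<And>j. j \<in> J \<Longrightarrow> chart K l (flip (\<sigma> j) x) = chart K m (flip j p)"
  shows "chart K m ` sub m J p \<subseteq> chart K l ` sub l (\<sigma> ` J) x"
proof
  fix y assume "y \<in> chart K m ` sub m J p"
  then obtain z where z: "y = chart K m z" "z \<in> cube_of K m" "\<And>i. i \<notin> J \<Longrightarrow> z i = p i"
    by (auto simp: subface_def cube_of_def)
  have pc: "p \<in> cube_of K m" and xc: "x \<in> cube_of K l"
    using p x by (auto intro: vert_cube)
  have fl: "flip j p \<in> cube_of K m" "flip (\<sigma> j) x \<in> cube_of K l" if "j \<in> J" for j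
    using that J \<sigma>(1) p x by (auto intro!: vert_cube flip_vertex)
  have "chart K m p \<in> cell_of l"
    using xp xc by (metis image_eqI)
  then obtain J0 where J0: "J0 \<subseteq> {..<cdim K m}" "\<forall>i. i \<notin> J0 \<longrightarrow> p i = 0 \<or> p i = 1"
    "\<forall>z\<in>cube_of K m. chart K m z \<in> cell_of l \<longleftrightarrow> (\<forall>i. i \<notin> J0 \<longrightarrow> z i = p i)"
    by (rule glue_face[OF m l pc])
  have "j \<in> J0" if "j \<in> J" for j
  proof (rule ccontr)
    assume "j \<notin> J0"
    moreover have "chart K m (flip j p) \<in> cell_of l"
      using \<sigma>(2)[OF that] fl(2)[OF that] by (metis image_eqI)
    ultimately have "flip j p j = p j"
      using J0(3)[rule_format, OF fl(1)[OF that]] by blast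
    then show False
      using cube_vertex_cases[OF p, of j] by (auto simp: flip_apply)
  qed
  then have "chart K m z \<in> cell_of l"
    using J0(3)[rule_format, OF z(2)] z(3) by blast
  then obtain z' where z': "z' \<in> cube_of K l" "chart K l z' = chart K m z"
    by (metis imageE)
  have d: "ed l z' x = ed m z p"
    using glue_dist[OF l m z'(1) z(2) z'(2) xc pc xp] .
  have coord: "\<bar>z' (\<sigma> j) - x (\<sigma> j)\<bar> = \<bar>z j - p j\<bar>" if "j \<in> J" for j
  proof -
    have "ed l z' (flip (\<sigma> j) x) = ed m z (flip j p)"
      using glue_dist[OF l m z'(1) z(2) z'(2) fl(2) fl(1) \<sigma>(2)] that by blast
    then show ?thesis
      using eucl_dist_flip_sq[OF x, of z' "\<sigma> j"] eucl_dist_flip_sq[OF p, of z j] d z' z that J \<sigma>(1)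
      by (auto simp: cube_of_def)
  qed
  have inj: "inj_on \<sigma> J"
  proof (rule inj_onI)
    fix i j assume ij: "i \<in> J" "j \<in> J" "\<sigma> i = \<sigma> j"
    then have "chart K m (flip i p) = chart K m (flip j p)"
      using \<sigma>(2) by metis
    then show "i = j"
      using chart_inj[OF m fl(1)[OF ij(1)] fl(1)[OF ij(2)]] flip_eq_iff[OF p] by simp
  qed
  let ?n = "cdim K l"
  have "(\<Sum>i<?n. (z' i - x i)\<^sup>2) = (\<Sum>j<cdim K m. (z j - p j)\<^sup>2)"
    using d by (simp flip: eucl_dist_power2)
  also have "\<dots> = (\<Sum>j\<in>J. (z j - p j)\<^sup>2)"
    using J z(3) by (intro sum.mono_neutral_right) auto
  also have "\<dots> = (\<Sum>j\<in>J. (z' (\<sigma> j) - x (\<sigma> j))\<^sup>2)"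
    using coord by (intro sum.cong refl) (metis power2_abs)
  also have "\<dots> = (\<Sum>i\<in>\<sigma> ` J. (z' i - x i)\<^sup>2)"
    using inj by (simp add: sum.reindex)
  finally have "(\<Sum>i\<in>{..<?n} - \<sigma> ` J. (z' i - x i)\<^sup>2) = 0"
    using \<sigma>(1) by (subst sum_diff) auto
  then have "\<forall>i\<in>{..<?n} - \<sigma> ` J. (z' i - x i)\<^sup>2 = 0"
    by (subst (asm) sum_nonneg_eq_0_iff) auto
  then have "z' i = x i" if "i \<notin> \<sigma> ` J" for i
    using that z'(1) xc by (cases "i < ?n") (auto simp: cube_of_def unit_cubeD(3))
  then have "z' \<in> sub l (\<sigma> ` J) x"
    using z'(1) by (auto simp: subface_def cube_of_def)
  then show "y \<in> chart K l ` sub l (\<sigma> ` J) x"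
    using z(1) z'(2) by (metis image_eqI)
qed

section \<open>Cells, vertices and edges in cube coordinates\<close>

lemma is_cell_iff:
  "is_cell K k \<alpha> \<longleftrightarrow> (\<exists>l\<in>Cubes K. \<exists>x\<in>vert l. \<exists>J\<subseteq>{..<cdim K l}. card J = k \<and> \<alpha> = chart K l ` sub l J x)"
proof
  assume "is_cell K k \<alpha>"
  then obtain l F where l: "l \<in> Cubes K" "cube_face (cdim K l) k F" "\<alpha> = chart K l ` F"
    unfolding is_cell_def by blast
  obtain J where J: "J \<subseteq> {..<cdim K l}" "card J = k" "F \<subseteq> unit_cube (cdim K l)"
    "\<forall>x\<in>F. F = sub l J x" "\<forall>x\<in>F. \<forall>i. i \<notin> J \<longrightarrow> x i = 0 \<or> x i = 1"
    "\<exists>x\<in>vert l. x \<in> F"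
    by (rule cube_faceE[OF l(2)])
  then show "\<exists>l\<in>Cubes K. \<exists>x\<in>vert l. \<exists>J\<subseteq>{..<cdim K l}. card J = k \<and> \<alpha> = chart K l ` sub l J x"
    using l by metis
next
  assume "\<exists>l\<in>Cubes K. \<exists>x\<in>vert l. \<exists>J\<subseteq>{..<cdim K l}. card J = k \<and> \<alpha> = chart K l ` sub l J x"
  then show "is_cell K k \<alpha>"
    unfolding is_cell_def using cube_face_subface by metis
qed

lemma subface_0: "x \<in> vert l \<Longrightarrow> sub l {} x = {x}"
  using cube_vertices_subset by (auto simp: subface_def)

definition vertices :: "'a set" where
  "vertices = {w. is_cell K 0 {w}}"

lemma vertices_iff: "w \<in> vertices \<longleftrightarrow> (\<exists>l\<in>Cubes K. \<exists>x\<in>vert l. w = chart K l x)"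
proof
  assume "w \<in> vertices"
  then obtain l x J where *: "l \<in> Cubes K" "x \<in> vert l" "J \<subseteq> {..<cdim K l}" "card J = 0"
    "{w} = chart K l ` sub l J x"
    unfolding vertices_def is_cell_iff by blast
  then have "J = {}"
    by (simp add: finite_subset)
  with * show "\<exists>l\<in>Cubes K. \<exists>x\<in>vert l. w = chart K l x"
    by (auto simp: subface_0)
next
  assume "\<exists>l\<in>Cubes K. \<exists>x\<in>vert l. w = chart K l x"
  then obtain l x where "l \<in> Cubes K" "x \<in> vert l" "w = chart K l x"
    by blast
  then show "w \<in> vertices"
    unfolding vertices_def is_cell_iff mem_Collect_eq
    by (intro bexI[of _ l] bexI[of _ x] exI[of _ "{}"]) (auto simp: subface_0)
qed

lemma vertex_coord:
  "w \<in> vertices \<Longrightarrow> l \<in> Cubes K \<Longrightarrow> x \<in> cube_of K l \<Longrightarrow> w = chart K l x \<Longrightarrow> x \<in> vert l"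
  unfolding vertices_iff using glue_vertex by metis

definition nbr :: "'a \<Rightarrow> 'a \<Rightarrow> bool" where
  "nbr w a \<longleftrightarrow> (\<exists>l\<in>Cubes K. \<exists>x\<in>vert l. \<exists>i<cdim K l. w = chart K l x \<and> a = chart K l (flip i x))"

lemma nbr_vertices: "nbr w a \<Longrightarrow> w \<in> vertices" "nbr w a \<Longrightarrow> a \<in> vertices"
  unfolding nbr_def vertices_iff using flip_vertex by blast+

text \<open>The edge may be witnessed in another cube, but its length 1 survives gluing, and corners
  at distance 1 differ by one flip.\<close>

lemma nbr_in_cube:
  assumes "nbr w a" "l \<in> Cubes K" "x \<in> vert l" "w = chart K l x" "a \<in> cell_of l"
  obtains i where "i < cdim K l" "a = chart K l (flip i x)"
proof -
  obtain m y j where m: "m \<in> Cubes K" "y \<in> vert m" "j < cdim K m" "w = chart K m y"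
    "a = chart K m (flip j y)"
    using assms(1) unfolding nbr_def by blast
  obtain z where z: "z \<in> cube_of K l" "a = chart K l z"
    using assms(5) by blast
  then have zv: "z \<in> vert l"
    using nbr_vertices(2)[OF assms(1)] assms(2) vertex_coord by blast
  have "ed l x z = ed m y (flip j y)"
    using assms m z by (intro glue_dist) (auto intro!: vert_cube flip_vertex)
  then have "ed l x z = 1"
    using eucl_dist_flip[OF m(2,3)] by simp
  then obtain i where "i < cdim K l" "z = flip i x"
    using cube_vertices_dist_1[OF assms(3) zv] by blast
  then show ?thesis
    using that z by blast
qed

text \<open>A cell is determined by its edges at one corner. If the far ends of these edges lie in
  \<open>l\<close>, the whole cell is therefore a face of \<open>l\<close>.\<close>

lemma face_transfer:
  assumes l: "l \<in> Cubes K" and x: "x \<in> vert l" and \<alpha>: "\<alpha> \<in> cells K" "chart K l x \<in> \<alpha>"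
    and nbrs: "\<And>a. a \<in> \<alpha> \<Longrightarrow> nbr (chart K l x) a \<Longrightarrow> a \<in> cell_of l"
  obtains J where "J \<subseteq> {..<cdim K l}" "\<alpha> = chart K l ` sub l J x"
proof -
  obtain k where "is_cell K k \<alpha>"
    using \<alpha>(1) by (auto simp: cells_def)
  then obtain m p' J where m: "m \<in> Cubes K" "p' \<in> vert m" "J \<subseteq> {..<cdim K m}"
    "\<alpha> = chart K m ` sub m J p'"
    unfolding is_cell_iff by blast
  obtain p where p: "p \<in> sub m J p'" "chart K l x = chart K m p"
    using \<alpha>(2) m(4) by blast
  then have pv: "p \<in> vert m"
    using m(1) x l by (intro glue_vertex[of l m x p]) (auto simp: subface_def cube_of_def)
  have "sub m J p = sub m J p'"
    using p(1) by (auto simp: subface_def)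
  then have \<alpha>p: "\<alpha> = chart K m ` sub m J p"
    using m(4) by simp
  have "\<exists>i<cdim K l. chart K l (flip i x) = chart K m (flip j p)" if "j \<in> J" for j
  proof -
    have "flip j p \<in> sub m J p"
      using that m(3) flip_vertex[OF pv] cube_vertices_subset by (auto simp: subface_def flip_apply)
    moreover have n: "nbr (chart K l x) (chart K m (flip j p))"
      unfolding nbr_def p(2) using m(1,3) pv that by blast
    ultimately have "chart K m (flip j p) \<in> cell_of l"
      using nbrs \<alpha>p by blast
    from nbr_in_cube[OF n l x refl this] show ?thesis
      by metis
  qed
  then obtain \<sigma> where \<sigma>: "\<And>j. j \<in> J \<Longrightarrow> \<sigma> j < cdim K l"
    "\<And>j. j \<in> J \<Longrightarrow> chart K l (flip (\<sigma> j) x) = chart K m (flip j p)"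
    by metis
  have inj: "inj_on \<sigma> J"
  proof (rule inj_onI)
    fix i j assume ij: "i \<in> J" "j \<in> J" "\<sigma> i = \<sigma> j"
    then have "chart K m (flip i p) = chart K m (flip j p)"
      using \<sigma>(2) by metis
    then show "i = j"
      using chart_inj[OF m(1) vert_cube vert_cube, OF flip_vertex flip_vertex, OF pv _ pv] ij m(3)
        flip_eq_iff[OF pv] by auto
  qed
  \<comment> \<open>The inverse of \<open>\<sigma>\<close> yields the reverse inclusion, from the
    same lemma with the two cubes exchanged.\<close>
  define \<tau> where "\<tau> = the_inv_into J \<sigma>"
  have \<tau>: "\<tau> (\<sigma> j) = j" if "j \<in> J" for j
    unfolding \<tau>_def using the_inv_into_f_f[OF inj that] .
  have "chart K m ` sub m J p \<subseteq> chart K l ` sub l (\<sigma> ` J) x"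
    using face_transfer_aux[OF l m(1) x pv p(2) m(3) \<sigma>] .
  moreover have "chart K l ` sub l (\<sigma> ` J) x \<subseteq> chart K m ` sub m (\<tau> ` \<sigma> ` J) p"
    using \<sigma> m(3) by (intro face_transfer_aux[OF m(1) l pv x p(2)[symmetric]]) (auto simp: \<tau>)
  moreover have "\<tau> ` \<sigma> ` J = J"
    by (force simp: \<tau> image_image)
  ultimately show ?thesis
    using \<sigma>(1) \<alpha>p by (intro that[of "\<sigma> ` J"]) auto
qed

end

text \<open>Minkowski's inequality for the vectors \<open>(b, k)\<close> and \<open>(c, 0)\<close>.
  It shows that a distance combined with a fixed orthogonal offset \<open>k\<close> remains
  1-Lipschitz.\<close>

lemma sqrt_add_le:
  fixes a b c k :: real
  assumes "a \<le> b + c" "0 \<le> a" "0 \<le> b" "0 \<le> c"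
  shows "sqrt (a\<^sup>2 + k\<^sup>2) \<le> sqrt (b\<^sup>2 + k\<^sup>2) + c"
proof -
  have "sqrt (a\<^sup>2 + k\<^sup>2) \<le> sqrt ((b + c)\<^sup>2 + (k + 0)\<^sup>2)"
    using assms by (simp add: power_mono)
  also have "\<dots> \<le> sqrt (b\<^sup>2 + k\<^sup>2) + sqrt (c\<^sup>2 + 0\<^sup>2)"
    by (rule real_sqrt_sum_squares_triangle_ineq)
  finally show ?thesis
    using assms by simp
qed

context cubical
begin

section \<open>Distances inside a single cube\<close>

definition coord :: "'i \<Rightarrow> 'a \<Rightarrow> nat \<Rightarrow> real" where
  "coord l = inv_into (cube_of K l) (chart K l)"

text \<open>This has geometric meaning only for points of \<open>cell_of l\<close>; symmetry and the
  triangle inequality hold for all arguments, as \<open>coord\<close> is total.\<close>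

definition pd :: "'i \<Rightarrow> 'a \<Rightarrow> 'a \<Rightarrow> real" where
  "pd l p q = ed l (coord l p) (coord l q)"

lemma coord: "p \<in> cell_of l \<Longrightarrow> coord l p \<in> cube_of K l" "p \<in> cell_of l \<Longrightarrow> chart K l (coord l p) = p"
  unfolding coord_def by (simp_all only: inv_into_into f_inv_into_f)

lemma coord_chart [simp]: "l \<in> Cubes K \<Longrightarrow> x \<in> cube_of K l \<Longrightarrow> coord l (chart K l x) = x"
  using coord[of "chart K l x" l] chart_inj by blast

lemma pd_chart: "l \<in> Cubes K \<Longrightarrow> x \<in> cube_of K l \<Longrightarrow> y \<in> cube_of K l \<Longrightarrow>
    pd l (chart K l x) (chart K l y) = ed l x y"
  by (simp add: pd_def)

lemma pd_commute: "pd l p q = pd l q p"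
  by (simp add: pd_def eucl_dist_commute)

lemma pd_triangle: "pd l p r \<le> pd l p q + pd l q r"
  by (simp add: pd_def eucl_dist_triangle)

lemma pd_nonneg [simp]: "0 \<le> pd l p q"
  by (simp add: pd_def)

lemma pd_self [simp]: "pd l p p = 0"
  by (simp add: pd_def eucl_dist_eq_0)

lemma pd_glue:
  "l \<in> Cubes K \<Longrightarrow> m \<in> Cubes K \<Longrightarrow> p \<in> cell_of l \<Longrightarrow> p \<in> cell_of m \<Longrightarrow> q \<in> cell_of l \<Longrightarrow> q \<in> cell_of m \<Longrightarrow>
    pd l p q = pd m p q"
  unfolding pd_def by (rule glue_dist) (simp_all add: coord)

lemma coord_vertex: "w \<in> vertices \<Longrightarrow> l \<in> Cubes K \<Longrightarrow> w \<in> cell_of l \<Longrightarrow> coord l w \<in> vert l"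
  using vertex_coord coord by metis

lemma underlyingE:
  assumes "p \<in> underlying K"
  obtains l where "l \<in> Cubes K" "p \<in> cell_of l"
  using assms unfolding underlying_def by blast

lemma in_underlying: "l \<in> Cubes K \<Longrightarrow> p \<in> cell_of l \<Longrightarrow> p \<in> underlying K"
  unfolding underlying_def by blast

lemma vertices_underlying: "w \<in> vertices \<Longrightarrow> w \<in> underlying K"
  unfolding vertices_iff using in_underlying vert_cube by blast

section \<open>Bounds for the length metric\<close>

text \<open>A potential drops along each segment by at most the length of the segment. It carries a
  cube index because it is given in the coordinates of the cubes; \<open>compat\<close> allows the
  change of cube at a break point.\<close>

lemma polygonal_path_lower_bound:
  assumes path: "polygonal_path K p q r"
    and compat: "\<And>l m p. l \<in> Cubes K \<Longrightarrow> m \<in> Cubes K \<Longrightarrow> p \<in> cell_of l \<Longrightarrow> p \<in> cell_of m \<Longrightarrow> g l p = g m p"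
    and lip: "\<And>l p q. l \<in> Cubes K \<Longrightarrow> p \<in> cell_of l \<Longrightarrow> q \<in> cell_of l \<Longrightarrow> g l p \<le> g l q + pd l p q"
    and "l \<in> Cubes K" "p \<in> cell_of l" "m \<in> Cubes K" "q \<in> cell_of m"
  shows "g l p \<le> g m q + r"
  using path assms(4-)
proof (induction arbitrary: l)
  case (point p)
  then show ?case
    using compat[of l m p] by simp
next
  case (segment k u v q r)
  have "g l (chart K k u) = g k (chart K k u)"
    using segment by (intro compat) auto
  also have "\<dots> \<le> g k (chart K k v) + ed k u v"
    using lip[of k "chart K k u" "chart K k v"] segment by (simp add: pd_chart)
  also have "g k (chart K k v) \<le> g m q + r"
    using segment by blast
  finally show ?case
    by simp
qed

lemma polygonal_path_nonneg: "polygonal_path K p q r \<Longrightarrow> 0 \<le> r"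
  by (induction rule: polygonal_path.induct) auto

lemma length_edist_nonneg: "0 \<le> length_edist K p q"
  unfolding length_edist_def by (rule INF_greatest) (auto dest: polygonal_path_nonneg)

lemma length_dist_le_pd:
  assumes "l \<in> Cubes K" "p \<in> cell_of l" "q \<in> cell_of l"
  shows "length_dist K p q \<le> pd l p q"
proof -
  have "polygonal_path K (chart K l (coord l p)) q (ed l (coord l p) (coord l q) + 0)"
    using assms in_underlying by (intro polygonal_path.segment) (auto simp: coord intro!: polygonal_path.point)
  then have "polygonal_path K p q (pd l p q)"
    using assms by (simp add: coord pd_def)
  then have "length_edist K p q \<le> ereal (pd l p q)"
    unfolding length_edist_def by (intro INF_lower) simp
  then show ?thesis
    unfolding length_dist_def using length_edist_nonneg[of p q]
    by (cases "length_edist K p q") auto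
qed

text \<open>The infimum over all paths. Finiteness is assumed because an infinite distance is
  converted to the real number 0.\<close>

lemma length_dist_lower_bound:
  assumes "length_edist K p q < \<infinity>"
    and compat: "\<And>l m p. l \<in> Cubes K \<Longrightarrow> m \<in> Cubes K \<Longrightarrow> p \<in> cell_of l \<Longrightarrow> p \<in> cell_of m \<Longrightarrow> g l p = g m p"
    and lip: "\<And>l p q. l \<in> Cubes K \<Longrightarrow> p \<in> cell_of l \<Longrightarrow> q \<in> cell_of l \<Longrightarrow> g l p \<le> g l q + pd l p q"
    and "l \<in> Cubes K" "p \<in> cell_of l" "m \<in> Cubes K" "q \<in> cell_of m"
  shows "g l p \<le> g m q + length_dist K p q"
proof -
  have "ereal (g l p - g m q) \<le> length_edist K p q"
    unfolding length_edist_def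
  proof (rule INF_greatest)
    fix r assume "r \<in> {r. polygonal_path K p q r}"
    then have "g l p \<le> g m q + r"
      by (intro polygonal_path_lower_bound[where g = g, OF _ assms(2-)]) simp
    then show "ereal (g l p - g m q) \<le> ereal r"
      by simp
  qed
  then show ?thesis
    unfolding length_dist_def using length_edist_nonneg[of p q] assms(1)
    by (cases "length_edist K p q") auto
qed

text \<open>The overlap with \<open>m\<close> is a face of \<open>l\<close> that misses
  \<open>w\<close>, so a coordinate that is constant on it separates \<open>p\<close> from
  \<open>w\<close> by 1.\<close>

lemma pd_vertex_ge_1:
  assumes l: "l \<in> Cubes K" and m: "m \<in> Cubes K" and p: "p \<in> cell_of l" "p \<in> cell_of m"
    and w: "w \<in> vertices" "w \<in> cell_of l" "w \<notin> cell_of m"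
  shows "1 \<le> pd l p w"
proof -
  let ?u = "coord l p" and ?x = "coord l w"
  have u: "?u \<in> cube_of K l" "chart K l ?u \<in> cell_of m" and x: "?x \<in> vert l" "?x \<in> cube_of K l"
    using coord p w coord_vertex l by auto
  obtain J where J: "J \<subseteq> {..<cdim K l}" "\<forall>i. i \<notin> J \<longrightarrow> ?u i = 0 \<or> ?u i = 1"
    "\<forall>z\<in>cube_of K l. chart K l z \<in> cell_of m \<longleftrightarrow> (\<forall>i. i \<notin> J \<longrightarrow> z i = ?u i)"
    by (rule glue_face[OF l m u])
  obtain i where i: "i \<notin> J" "?x i \<noteq> ?u i"
    using J(3)[rule_format, OF x(2)] w coord by auto
  then have "i < cdim K l"
    using u x unit_cubeD(3) by (metis cube_of_def linorder_not_le)
  moreover have "\<bar>?u i - ?x i\<bar> = 1"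
    using J(2)[rule_format, OF i(1)] i(2) cube_vertex_cases[OF x(1), of i] by auto
  ultimately show ?thesis
    unfolding pd_def by (metis coord_le_eucl_dist)
qed

text \<open>The potential is the distance to \<open>w\<close>, cut off at 1, and equal to 1 on cubes
  without \<open>w\<close>; \<open>pd_vertex_ge_1\<close> makes it agree on overlaps. A value below
  1 at \<open>q\<close> forces \<open>w\<close> into the cube of \<open>q\<close>.\<close>

lemma vertex_lower_bound:
  assumes w: "w \<in> vertices" and fin: "length_edist K q p < \<infinity>"
    and p: "l \<in> Cubes K" "p \<in> cell_of l" "w \<in> cell_of l" and q: "m \<in> Cubes K" "q \<in> cell_of m"
    and less: "pd l p w + length_dist K q p < 1"
  shows "w \<in> cell_of m \<and> pd m q w \<le> pd l p w + length_dist K q p"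
proof -
  define g where "g l p = (if w \<in> cell_of l then min 1 (pd l p w) else 1)" for l p
  have "g m q \<le> g l p + length_dist K q p"
  proof (rule length_dist_lower_bound[where g = g, OF fin _ _ q p(1,2)])
    fix l m p assume "l \<in> Cubes K" "m \<in> Cubes K" "p \<in> cell_of l" "p \<in> cell_of m"
    then show "g l p = g m p"
      unfolding g_def using pd_vertex_ge_1[of l m p w] pd_vertex_ge_1[of m l p w] pd_glue[of l m p w] w
      by auto
  next
    fix l p q assume "l \<in> Cubes K" "p \<in> cell_of l" "q \<in> cell_of l"
    then show "g l p \<le> g l q + pd l p q"
      unfolding g_def by (smt (verit) pd_nonneg pd_triangle)
  qed
  then show ?thesis
    using less p by (auto simp: g_def split: if_splits)
qed

section \<open>Points on edges\<close>

definition edge_point :: "nat \<Rightarrow> real \<Rightarrow> (nat \<Rightarrow> real) \<Rightarrow> nat \<Rightarrow> real" where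
  "edge_point i s x = x(i := (1 - s) * x i + s * (1 - x i))"

lemma edge_point_convex: "edge_point i s x j = (1 - s) * x j + s * flip i x j"
  by (simp add: edge_point_def flip_apply algebra_simps)

lemma edge_point_0: "edge_point i 0 x = x" and edge_point_1: "edge_point i 1 x = flip i x"
  by (auto simp: edge_point_convex)

lemma edge_point_cube:
  assumes "x \<in> vert l" "i < cdim K l" "0 \<le> s" "s \<le> 1"
  shows "edge_point i s x \<in> cube_of K l"
  using assms cube_vertex_cases[OF assms(1), of i] vert_cube[OF assms(1)]
  by (auto simp: edge_point_def cube_of_def unit_cube_def)

lemma edge_point_dist:
  assumes "x \<in> vert l" "i < cdim K l"
  shows "ed l (edge_point i s x) (edge_point i s' x) = \<bar>s - s'\<bar>"
proof -
  have "(ed l (edge_point i s x) (edge_point i s' x))\<^sup>2 = \<bar>s - s'\<bar>\<^sup>2"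
    using assms(2) cube_vertex_cases[OF assms(1), of i] unfolding eucl_dist_power2
    by (auto simp: sum.remove[of "{..<cdim K l}" i] edge_point_def power2_eq_square algebra_simps)
  then show ?thesis
    by (rule power2_eq_imp_eq) simp_all
qed

text \<open>The witnessing cube is a parameter because the same point must be located in the
  coordinates of every cube that contains it.\<close>

definition on_edge :: "'i \<Rightarrow> 'a \<Rightarrow> 'a \<Rightarrow> real \<Rightarrow> 'a \<Rightarrow> bool" where
  "on_edge l w a s y \<longleftrightarrow> l \<in> Cubes K \<and> (\<exists>x\<in>vert l. \<exists>i<cdim K l. w = chart K l x \<and>
     a = chart K l (flip i x) \<and> y = chart K l (edge_point i s x))"

text \<open>Coordinate \<open>i\<close> of an interior point of the edge is neither 0 nor 1, so
  direction \<open>i\<close> is free in the overlap and both ends lie in \<open>m\<close>. The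
  distances \<open>s\<close>, \<open>1 - s\<close> and 1 then fix the position of \<open>y\<close>
  in \<open>m\<close>.\<close>

lemma on_edge_transfer:
  assumes e: "on_edge l w a s y" and m: "m \<in> Cubes K" "y \<in> cell_of m" and s: "0 < s" "s < 1"
  shows "on_edge m w a s y"
proof -
  obtain x i where x: "l \<in> Cubes K" "x \<in> vert l" "i < cdim K l" "w = chart K l x"
    "a = chart K l (flip i x)" "y = chart K l (edge_point i s x)"
    using e unfolding on_edge_def by blast
  have fx: "flip i x \<in> vert l"
    using x flip_vertex by blast
  have yc: "edge_point i s x \<in> cube_of K l"
    using edge_point_cube x s by simp
  have "chart K l (edge_point i s x) \<in> cell_of m"
    using m(2) x(6) by simp
  then obtain J where J: "J \<subseteq> {..<cdim K l}"
    "\<forall>i'. i' \<notin> J \<longrightarrow> edge_point i s x i' = 0 \<or> edge_point i s x i' = 1"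
    "\<forall>z\<in>cube_of K l. chart K l z \<in> cell_of m \<longleftrightarrow> (\<forall>i'. i' \<notin> J \<longrightarrow> z i' = edge_point i s x i')"
    by (rule glue_face[OF x(1) m(1) yc])
  have "i \<in> J"
  proof (rule ccontr)
    assume "i \<notin> J"
    then show False
      using J(2)[rule_format, of i] s cube_vertex_cases[OF x(2), of i] by (auto simp: edge_point_def)
  qed
  then have wa: "w \<in> cell_of m" "a \<in> cell_of m"
    unfolding x(4,5) using J(3)[rule_format, OF vert_cube[OF x(2)]] J(3)[rule_format, OF vert_cube[OF fx]]
    by (auto simp: edge_point_def flip_apply)
  let ?w = "coord m w" and ?a = "coord m a" and ?y = "coord m y"
  have v: "?w \<in> vert m" "?a \<in> vert m"
    using coord_vertex[OF _ m(1)] wa x fx vertices_iff by blast+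
  have d: "pd m w y = s" "pd m y a = 1 - s" "pd m w a = 1"
  proof -
    have wl: "w \<in> cell_of l" "a \<in> cell_of l" "y \<in> cell_of l"
      using x yc vert_cube fx by auto
    have "pd m w y = pd l w y" "pd m y a = pd l y a" "pd m w a = pd l w a"
      using pd_glue[OF x(1) m(1)] wa m(2) wl by auto
    then show "pd m w y = s" "pd m y a = 1 - s" "pd m w a = 1"
      using edge_point_dist[OF x(2,3), of 0 s] edge_point_dist[OF x(2,3), of s 1]
        edge_point_dist[OF x(2,3), of 0 1] s
      by (simp_all add: x(4-6) pd_chart x(1) yc vert_cube[OF x(2)] vert_cube[OF fx]
          edge_point_0 edge_point_1)
  qed
  obtain j where j: "j < cdim K m" "?a = flip j ?w"
    using cube_vertices_dist_1[OF v] d(3) unfolding pd_def by blast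
  have "?y = edge_point j s ?w"
  proof (rule unit_cube_eqI)
    show "?y \<in> unit_cube (cdim K m)" "edge_point j s ?w \<in> unit_cube (cdim K m)"
      using coord(1)[OF m(2)] edge_point_cube[OF v(1) j(1)] s by (auto simp: cube_of_def)
    show "?y k = edge_point j s ?w k" if "k < cdim K m" for k
      unfolding edge_point_convex j(2)[symmetric] using d that
      by (intro between_unique[of "cdim K m"]) (simp_all add: pd_def)
  qed
  then show ?thesis
    unfolding on_edge_def using m v j coord(2) wa by metis
qed

text \<open>The potential \<open>g\<close> is the distance to \<open>y\<close> in cubes containing
  \<open>y\<close>. In cubes with \<open>w\<close> but not \<open>y\<close> it is the hypotenuse
  over the distance to \<open>w\<close> and the offset \<open>s\<close>. Both are cut off at
  \<open>1 - s\<close>, the distance from \<open>y\<close> to the far end of the edge, which is also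
  the value elsewhere. If \<open>y\<close> were outside \<open>m\<close>, the value at
  \<open>q\<close> would contradict one of the two bounds in \<open>less\<close>.\<close>

lemma edge_point_lower_bound:
  assumes e: "on_edge k w a s y" and s: "0 < s" "s < 1" and fin: "length_edist K q y < \<infinity>"
    and q: "m \<in> Cubes K" "q \<in> cell_of m" "w \<in> cell_of m"
    and less: "length_dist K q y < 1 - s" "(length_dist K q y)\<^sup>2 < (pd m q w)\<^sup>2 + s\<^sup>2"
  shows "y \<in> cell_of m \<and> pd m q y \<le> length_dist K q y"
proof -
  have on: "on_edge l w a s y" if "l \<in> Cubes K" "y \<in> cell_of l" for l
    using on_edge_transfer[OF e that s] .
  have w: "w \<in> vertices"
    using e unfolding on_edge_def vertices_iff by blast
  have yw: "w \<in> cell_of l" if "l \<in> Cubes K" "y \<in> cell_of l" for l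
    using on[OF that] vert_cube unfolding on_edge_def by blast
  define g where "g l p = (if y \<in> cell_of l then min (1 - s) (pd l p y)
      else if w \<in> cell_of l then min (1 - s) (sqrt ((pd l p w)\<^sup>2 + s\<^sup>2)) else 1 - s)" for l p
  have compat1: "g l p = g m p"
    if l: "l \<in> Cubes K" and m: "m \<in> Cubes K" and p: "p \<in> cell_of l" "p \<in> cell_of m"
      and y: "y \<in> cell_of l" "y \<notin> cell_of m" for l m p
  proof -
    obtain x i where x: "x \<in> vert l" "i < cdim K l" "w = chart K l x" "y = chart K l (edge_point i s x)"
      using on[OF l y(1)] unfolding on_edge_def by blast
    let ?u = "coord l p" and ?y = "edge_point i s x"
    have xc: "x \<in> cube_of K l" and yc: "?y \<in> cube_of K l"
      using x edge_point_cube s by (auto intro: vert_cube)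
    have u: "?u \<in> cube_of K l" "chart K l ?u \<in> cell_of m"
      using coord p by auto
    have pdy: "pd l p y = ed l ?u ?y" and pdw: "pd l p w = ed l ?u x"
      using l xc yc by (simp_all add: pd_def x(3,4))
    obtain J where J: "J \<subseteq> {..<cdim K l}" "\<forall>i'. i' \<notin> J \<longrightarrow> ?u i' = 0 \<or> ?u i' = 1"
      "\<forall>z\<in>cube_of K l. chart K l z \<in> cell_of m \<longleftrightarrow> (\<forall>i'. i' \<notin> J \<longrightarrow> z i' = ?u i')"
      by (rule glue_face[OF l m u])
    show ?thesis
    proof (cases "w \<in> cell_of m")
      case True
      then have xu: "x i' = ?u i'" if "i' \<notin> J" for i'
        using J(3)[rule_format, OF xc] x(3) that by metis
      \<comment> \<open>The overlap contains \<open>w\<close> but not \<open>y\<close>, so it is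
        orthogonal to the edge, and Pythagoras at \<open>w\<close> makes the two formulas for
        \<open>g\<close> agree.\<close>
      have "i \<notin> J"
      proof
        assume "i \<in> J"
        then have "y \<in> cell_of m"
          unfolding x(4) using J(3)[rule_format, OF yc] xu by (auto simp: edge_point_def)
        then show False
          using y by blast
      qed
      then have "\<bar>?u i - x i\<bar> = 0"
        using xu by simp
      then have "(ed l ?u (flip i x))\<^sup>2 = (ed l ?u x)\<^sup>2 + 1"
        using eucl_dist_flip_sq[OF x(1) _ x(2), of ?u] u(1) by (simp add: cube_of_def)
      moreover have "(ed l ?u ?y)\<^sup>2 = (1 - s) * (ed l ?u x)\<^sup>2 + s * (ed l ?u (flip i x))\<^sup>2
          - s * (1 - s) * (ed l x (flip i x))\<^sup>2"
        by (rule stewart) (rule edge_point_convex)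
      ultimately have "(ed l ?u ?y)\<^sup>2 = (ed l ?u x)\<^sup>2 + s\<^sup>2"
        using eucl_dist_flip[OF x(1,2)] by (simp add: power2_eq_square algebra_simps)
      then have "pd l p y = sqrt ((pd l p w)\<^sup>2 + s\<^sup>2)"
        unfolding pdy pdw by (metis eucl_dist_nonneg real_sqrt_unique)
      moreover have "pd l p w = pd m p w"
        using pd_glue[OF l m p] yw[OF l y(1)] True by blast
      ultimately show ?thesis
        using y True by (simp add: g_def)
    next
      case False
      \<comment> \<open>An overlap without \<open>w\<close> lies in a facet opposite to
        \<open>w\<close>, which is at distance \<open>1 - s\<close> or 1 from \<open>y\<close>, so
        the cutoff applies.\<close>
      then obtain j where j: "j \<notin> J" "x j \<noteq> ?u j"
        using J(3)[rule_format, OF xc] x(3) by metis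
      then have "j < cdim K l"
        using u(1) xc unit_cubeD(3) by (metis cube_of_def linorder_not_le)
      moreover have "1 - s \<le> \<bar>?u j - ?y j\<bar>"
        using J(2)[rule_format, OF j(1)] j(2) cube_vertex_cases[OF x(1), of j] s by (auto simp: edge_point_def)
      ultimately have "1 - s \<le> pd l p y"
        unfolding pdy by (meson coord_le_eucl_dist order_trans)
      then show ?thesis
        using y False by (simp add: g_def)
    qed
  qed
  \<comment> \<open>A point in the overlap with a cube that misses \<open>w\<close> has distance at
    least 1 from \<open>w\<close>, so the hypotenuse is cut off as well.\<close>
  have compat2: "g l p = g m p"
    if l: "l \<in> Cubes K" and m: "m \<in> Cubes K" and p: "p \<in> cell_of l" "p \<in> cell_of m"
      and y: "y \<notin> cell_of l" "y \<notin> cell_of m" "w \<in> cell_of l" "w \<notin> cell_of m" for l m p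
  proof -
    have "1 \<le> pd l p w"
      using pd_vertex_ge_1[OF l m p w y(3,4)] .
    also have "\<dots> \<le> sqrt ((pd l p w)\<^sup>2 + s\<^sup>2)"
      by (rule real_sqrt_sum_squares_ge1)
    finally have "1 - s \<le> sqrt ((pd l p w)\<^sup>2 + s\<^sup>2)"
      using s by linarith
    then show ?thesis
      by (simp only: g_def y if_False if_True simp_thms min.absorb1)
  qed
  have "g m q \<le> g k y + length_dist K q y"
  proof (rule length_dist_lower_bound[where g = g, OF fin _ _ q(1,2)])
    show "k \<in> Cubes K" "y \<in> cell_of k"
      using e edge_point_cube s unfolding on_edge_def by fastforce+
  next
    fix l m p assume *: "l \<in> Cubes K" "m \<in> Cubes K" "p \<in> cell_of l" "p \<in> cell_of m"
    consider "y \<in> cell_of l" "y \<notin> cell_of m" | "y \<notin> cell_of l" "y \<in> cell_of m"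
      | "y \<in> cell_of l" "y \<in> cell_of m"
      | "y \<notin> cell_of l" "y \<notin> cell_of m" "w \<in> cell_of l" "w \<notin> cell_of m"
      | "y \<notin> cell_of l" "y \<notin> cell_of m" "w \<notin> cell_of l" "w \<in> cell_of m"
      | "y \<notin> cell_of l" "y \<notin> cell_of m" "w \<in> cell_of l \<longleftrightarrow> w \<in> cell_of m"
      by blast
    then show "g l p = g m p"
    proof cases
      case 1
      then show ?thesis
        by (rule compat1[OF *])
    next
      case 2
      then show ?thesis
        using compat1[OF *(2,1,4,3)] by simp
    next
      case 3
      then show ?thesis
        unfolding g_def by (simp only: if_True pd_glue[OF *])
    next
      case 4
      then show ?thesis
        by (rule compat2[OF *])
    next
      case 5
      then show ?thesis
        using compat2[OF *(2,1,4,3)] by simp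
    next
      case 6
      then show ?thesis
        unfolding g_def using pd_glue[OF *, of w] by (cases "w \<in> cell_of m") (simp_all only: if_False if_True simp_thms)
    qed
  next
    fix l p q assume "l \<in> Cubes K" "p \<in> cell_of l" "q \<in> cell_of l"
    have "sqrt ((pd l p w)\<^sup>2 + s\<^sup>2) \<le> sqrt ((pd l q w)\<^sup>2 + s\<^sup>2) + pd l p q"
      using pd_triangle[of l p w q] by (intro sqrt_add_le) auto
    then show "g l p \<le> g l q + pd l p q"
      unfolding g_def by (smt (verit) pd_nonneg pd_triangle)
  qed
  moreover have "g k y \<le> 0"
    using e edge_point_cube s unfolding on_edge_def g_def by fastforce
  ultimately have le: "g m q \<le> length_dist K q y"
    by simp
  moreover have "0 \<le> length_dist K q y"
    unfolding length_dist_def using length_edist_nonneg by (rule real_of_ereal_pos)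
  ultimately have "length_dist K q y < sqrt ((pd m q w)\<^sup>2 + s\<^sup>2)"
    using less(2) by (simp add: real_less_rsqrt)
  then show ?thesis
    using le less(1) q(3) by (auto simp: g_def split: if_splits)
qed

end

section \<open>The CAT(0) inequality\<close>

lemma dist_vector_2: "dist (vector [a, b] :: real^2) (vector [c, d]) = sqrt ((a - c)\<^sup>2 + (b - d)\<^sup>2)"
  by (simp add: dist_vec_def L2_set_def sum_2 dist_real_def)

lemma vector_2_closed_segment:
  assumes "0 \<le> u" "u \<le> 1"
  shows "vector [(1 - u) * a + u * c, (1 - u) * b + u * d] \<in> closed_segment (vector [a, b] :: real^2) (vector [c, d])"
proof -
  have "vector [(1 - u) * a + u * c, (1 - u) * b + u * d]
      = (1 - u) *\<^sub>R (vector [a, b] :: real^2) + u *\<^sub>R vector [c, d]"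
    by (simp add: vec_eq_iff forall_2)
  then show ?thesis
    unfolding closed_segment_def using assms by auto
qed

text \<open>Law of cosines in the comparison triangle, with \<open>w\<close> at the origin and
  \<open>v\<close> at \<open>(D, 0)\<close>. The cosine \<open>X\<close> of its angle at
  \<open>w\<close> is at least \<open>1 / (2 * D)\<close> because \<open>d a v \<le> D\<close>. As
  \<open>b\<close> runs from \<open>a\<close> to \<open>w\<close>, the point
  \<open>b (1 - s)\<close> is at distance \<open>s\<close> from \<open>w\<close>.\<close>

lemma CAT0_hinge:
  assumes cat: "CAT0_space M d" and M: "a \<in> M" "w \<in> M" "v \<in> M"
    and b: "geodesic M d a w b" and c: "geodesic M d w v c"
    and d: "d a w = 1" "d w v = D" "1 \<le> D" "d a v \<le> D"
    and t: "0 \<le> t" "t \<le> D" and s: "0 \<le> s" "s \<le> 1"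
  shows "(d (c t) (b (1 - s)))\<^sup>2 \<le> t\<^sup>2 + s\<^sup>2 - t * s / D"
proof -
  have ms: "Metric_space M d"
    using cat by (simp add: CAT0_space_def geodesic_space_def)
  obtain c' where c': "geodesic M d v a c'"
    using cat M unfolding CAT0_space_def geodesic_space_def by blast
  define e where "e = d v a"
  have e: "0 \<le> e" "e \<le> D" "D \<le> 1 + e"
    using d Metric_space.commute[OF ms] Metric_space.nonneg[OF ms] Metric_space.triangle[OF ms M(2,1,3)]
    by (auto simp: e_def)
  \<comment> \<open>The first coordinate of the point at distance 1 from the origin and
    \<open>e\<close> from \<open>(D, 0)\<close>. The triangle inequality
    \<open>D - 1 \<le> e\<close> gives \<open>X \<le> 1\<close>, so the second coordinate is
    real.\<close>
  define X where "X = (D\<^sup>2 + 1 - e\<^sup>2) / (2 * D)"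
  have e2: "e\<^sup>2 \<le> D\<^sup>2" "(D - 1)\<^sup>2 \<le> e\<^sup>2"
    using e d by (auto intro!: power_mono)
  have DX: "2 * D * X = D\<^sup>2 + 1 - e\<^sup>2"
    using d by (simp add: X_def)
  moreover have "D\<^sup>2 + 1 - e\<^sup>2 \<le> 2 * D * 1"
    using e2 by (simp add: power2_eq_square algebra_simps)
  ultimately have "2 * D * X \<le> 2 * D * 1"
    by linarith
  then have X1: "X \<le> 1"
    by (rule mult_left_le_imp_le) (use d in simp)
  have XD: "1 / (2 * D) \<le> X"
    unfolding X_def using e2 d by (intro divide_right_mono) auto
  moreover have "0 \<le> 1 / (2 * D)"
    using d by simp
  ultimately have X0: "0 \<le> X"
    by linarith
  define Y where "Y = sqrt (1 - X\<^sup>2)"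
  have Y: "X\<^sup>2 + Y\<^sup>2 = 1"
    unfolding Y_def using X0 X1 by (simp add: power_le_one)
  define p' q' r' :: "real^2" where "p' = vector [X, Y]" and "q' = vector [0, 0]" and "r' = vector [D, 0]"
  have "(D - X)\<^sup>2 + Y\<^sup>2 = e\<^sup>2"
    using DX Y by (simp add: power2_eq_square algebra_simps)
  then have dist': "dist p' q' = d a w" "dist q' r' = d w v" "dist r' p' = d v a"
    unfolding p'_def q'_def r'_def dist_vector_2 using Y d e
    by (simp_all add: e_def)
  have p1: "comparison_point d a w b p' q' (b (1 - s)) (vector [s * X, s * Y])"
    unfolding comparison_point_def
  proof (intro bexI conjI)
    show "vector [s * X, s * Y] \<in> closed_segment p' q'"
      unfolding p'_def q'_def using vector_2_closed_segment[of "1 - s" X 0 Y 0] s by simp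
    have "(X - s * X)\<^sup>2 + (Y - s * Y)\<^sup>2 = (1 - s)\<^sup>2 * (X\<^sup>2 + Y\<^sup>2)"
      by (simp add: power2_eq_square algebra_simps)
    then show "dist p' (vector [s * X, s * Y]) = 1 - s"
      unfolding p'_def dist_vector_2 using Y s by simp
  qed (use s d in auto)
  have p2: "comparison_point d w v c q' r' (c t) (vector [t, 0])"
    unfolding comparison_point_def
  proof (intro bexI conjI)
    show "vector [t, 0] \<in> closed_segment q' r'"
      unfolding r'_def q'_def using vector_2_closed_segment[of "t / D" 0 D 0 0] t d by simp
    show "dist q' (vector [t, 0]) = t"
      unfolding q'_def dist_vector_2 using t by simp
  qed (use t d in auto)
  have "d (c t) (b (1 - s)) \<le> dist (vector [t, 0] :: real^2) (vector [s * X, s * Y])"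
  proof -
    note cat[unfolded CAT0_space_def Let_def, THEN conjunct2, rule_format, OF M]
    then show ?thesis
      using b c c' dist' p1 p2 by blast
  qed
  then have "(d (c t) (b (1 - s)))\<^sup>2 \<le> (dist (vector [t, 0] :: real^2) (vector [s * X, s * Y]))\<^sup>2"
    using Metric_space.nonneg[OF ms] by (intro power_mono)
  also have "\<dots> = (t - s * X)\<^sup>2 + (0 - s * Y)\<^sup>2"
    unfolding dist_vector_2 by simp
  also have "\<dots> = t\<^sup>2 + s\<^sup>2 * (X\<^sup>2 + Y\<^sup>2) - 2 * t * s * X"
    by (simp add: power2_eq_square algebra_simps)
  also have "\<dots> = t\<^sup>2 + s\<^sup>2 - 2 * t * s * X"
    unfolding Y by simp
  also have "\<dots> \<le> t\<^sup>2 + s\<^sup>2 - 2 * t * s * (1 / (2 * D))"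
    using mult_left_mono[OF XD, of "2 * t * s"] t s by simp
  finally show ?thesis
    by simp
qed

section \<open>The length metric near vertices\<close>

locale cat0_square = cubical K for K :: "('i, 'a) cubes" +
  assumes dim: "complex_dim K 2" and lf: "locally_finite_complex K" and cat0: "CAT0_complex K"
begin

abbreviation d :: "'a \<Rightarrow> 'a \<Rightarrow> real" where
  "d \<equiv> length_dist K"

abbreviation M :: "'a set" where
  "M \<equiv> underlying K"

lemma metric: "Metric_space M d"
  using cat0 by (simp add: CAT0_complex_def CAT0_space_def geodesic_space_def)

lemmas d_nonneg = Metric_space.nonneg[OF metric]
lemmas d_commute = Metric_space.commute[OF metric]
lemmas d_triangle = Metric_space.triangle[OF metric]

lemma d_self: "p \<in> M \<Longrightarrow> d p p = 0"
  using Metric_space.zero[OF metric] by blast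

lemma finite_edist: "p \<in> M \<Longrightarrow> q \<in> M \<Longrightarrow> length_edist K p q < \<infinity>"
  using cat0 by (auto simp: CAT0_complex_def)

lemma ex_geodesic:
  assumes "p \<in> M" "q \<in> M"
  obtains c where "geodesic M d p q c"
  using cat0 assms unfolding CAT0_complex_def CAT0_space_def geodesic_space_def by blast

lemma cdim_le_2:
  assumes "l \<in> Cubes K"
  shows "cdim K l \<le> 2"
proof -
  have "is_cell K (cdim K l) (chart K l ` sub l {..<cdim K l} (\<lambda>_. 0))"
    unfolding is_cell_iff using assms
    by (intro bexI[of _ l] bexI[of _ "\<lambda>_. 0"] exI[of _ "{..<cdim K l}"]) (auto simp: cube_vertices_def)
  then show ?thesis
    using dim by (auto simp: complex_dim_def)
qed

text \<open>\<open>vertex_lower_bound\<close>, used with \<open>w\<close> itself as the far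
  endpoint, gives one inequality; the straight segment in \<open>l\<close> gives the other.\<close>

lemma pd_eq_d_vertex:
  assumes w: "w \<in> vertices" and p: "p \<in> M" and l: "l \<in> Cubes K" "p \<in> cell_of l" and less: "d w p < 1"
  shows "w \<in> cell_of l" "pd l p w = d w p"
proof -
  obtain k where k: "k \<in> Cubes K" "w \<in> cell_of k"
    using underlyingE vertices_underlying[OF w] by blast
  have "w \<in> cell_of l \<and> pd l p w \<le> pd k w w + d p w"
    using vertices_underlying[OF w] p l k less finite_edist
    by (intro vertex_lower_bound[OF w, of p w k l]) (auto simp: d_commute)
  moreover from this have "d w p \<le> pd l p w"
    using length_dist_le_pd[OF l(1), of w p] l(2) by (simp add: pd_commute)
  ultimately show "w \<in> cell_of l" "pd l p w = d w p"
    by (auto simp: d_commute)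
qed

lemma d_vertices_ge_1:
  assumes "w \<in> vertices" "v \<in> vertices" "w \<noteq> v"
  shows "1 \<le> d w v"
proof (rule ccontr)
  assume "\<not> 1 \<le> d w v"
  then have less: "d w v < 1"
    by simp
  obtain l where l: "l \<in> Cubes K" "v \<in> cell_of l"
    using underlyingE vertices_underlying[OF assms(2)] by blast
  have w: "w \<in> cell_of l" "pd l v w = d w v"
    using pd_eq_d_vertex[OF assms(1) vertices_underlying[OF assms(2)] l less] by auto
  have "coord l v \<noteq> coord l w"
    using coord(2) w(1) l(2) assms(3) by metis
  then have "1 \<le> pd l v w"
    unfolding pd_def using coord_vertex assms l w(1) by (intro cube_vertices_dist_ge_1) auto
  then show False
    using w less by simp
qed

lemma d_nbr: "nbr w a \<Longrightarrow> d a w = 1"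
proof -
  assume n: "nbr w a"
  then obtain l x i where x: "l \<in> Cubes K" "x \<in> vert l" "i < cdim K l" "w = chart K l x"
    "a = chart K l (flip i x)"
    unfolding nbr_def by blast
  have fx: "flip i x \<in> vert l"
    using x flip_vertex by blast
  have "d a w \<le> pd l a w"
    using x fx vert_cube by (intro length_dist_le_pd) auto
  also have "\<dots> = 1"
    using x fx vert_cube eucl_dist_flip[OF x(2,3)] by (simp add: pd_chart eucl_dist_commute)
  finally have "d a w \<le> 1" .
  moreover have "a \<noteq> w"
    using x chart_inj vert_cube fx flip_neq by metis
  then have "1 \<le> d a w"
    using nbr_vertices[OF n] by (intro d_vertices_ge_1)
  ultimately show ?thesis
    by simp
qed

text \<open>Segments bound all distances on the edge from above. Three consecutive pieces must add
  up to at least the distance 1 of the ends, so every bound is attained.\<close>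

lemma geodesic_edge:
  assumes l: "l \<in> Cubes K" and x: "x \<in> vert l" "i < cdim K l"
  shows "geodesic M d (chart K l (flip i x)) (chart K l x) (\<lambda>r. chart K l (edge_point i (1 - r) x))"
proof -
  let ?b = "\<lambda>r. chart K l (edge_point i (1 - r) x)"
  let ?a = "chart K l (flip i x)" and ?w = "chart K l x"
  have bM: "?b r \<in> cell_of l" if "r \<in> {0..1}" for r
    using edge_point_cube[OF x, of "1 - r"] that by auto
  have b01: "?b 0 = ?a" "?b 1 = ?w"
    by (simp_all add: edge_point_0 edge_point_1)
  have "nbr ?w ?a"
    unfolding nbr_def using assms by blast
  then have 1: "d ?a ?w = 1"
    by (rule d_nbr)
  have le: "d (?b r) (?b r') \<le> \<bar>r - r'\<bar>" if "r \<in> {0..1}" "r' \<in> {0..1}" for r r'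
  proof -
    have "d (?b r) (?b r') \<le> pd l (?b r) (?b r')"
      using bM that l by (intro length_dist_le_pd) auto
    also have "\<dots> = \<bar>r - r'\<bar>"
      using edge_point_cube[OF x] that l edge_point_dist[OF x] by (simp add: pd_chart)
    finally show ?thesis .
  qed
  have eq: "d (?b r) (?b r') = r' - r" if "r \<in> {0..1}" "r' \<in> {0..1}" "r \<le> r'" for r r'
  proof -
    have "1 \<le> d (?b 0) (?b r) + (d (?b r) (?b r') + d (?b r') (?b 1))"
      using d_triangle[of "?b 0" "?b r" "?b 1"] d_triangle[of "?b r" "?b r'" "?b 1"] that bM in_underlying l 1
      unfolding b01 by (smt (verit) atLeastAtMost_iff b01)
    then show ?thesis
      using le[of 0 r] le[of r r'] le[of r' 1] that by simp
  qed
  have "d (?b r) (?b r') = \<bar>r - r'\<bar>" if "r \<in> {0..1}" "r' \<in> {0..1}" for r r'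
    using eq[of r r'] eq[of r' r] that d_commute by (cases "r \<le> r'") auto
  then show ?thesis
    unfolding geodesic_def 1 using bM in_underlying l b01 by auto
qed

lemma geodesic_near_vertex:
  assumes w: "w \<in> vertices" and v: "v \<in> vertices" and c: "geodesic M d w v c" and "w \<noteq> v"
    and t: "0 \<le> t" "t < 1" and l: "l \<in> Cubes K" "c t \<in> cell_of l"
  shows "w \<in> cell_of l" "pd l (c t) w = t"
proof -
  have D: "1 \<le> d w v"
    using d_vertices_ge_1 w v assms(4) by blast
  then have "d w (c t) = t"
    using c t unfolding geodesic_def by force
  then show "w \<in> cell_of l" "pd l (c t) w = t"
    using pd_eq_d_vertex[OF w in_underlying[OF l] l] t by auto
qed

text \<open>An edge along which the distance to \<open>v\<close> does not increase makes an angle of less than \<open>\<pi>/2\<close>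
  with the geodesic to \<open>v\<close>, so it lies in every cube that contains the start of this geodesic.\<close>

lemma descending_nbr:
  assumes v: "v \<in> vertices" and c: "geodesic M d w v c" and wv: "w \<noteq> v"
    and t: "0 < t" "t < 1" and l: "l \<in> Cubes K" "c t \<in> cell_of l"
    and a: "nbr w a" "d a v \<le> d w v"
  shows "a \<in> cell_of l" "(pd l (c t) a)\<^sup>2 \<le> t\<^sup>2 + 1 - t / d w v"
proof -
  have w: "w \<in> vertices" and av: "a \<in> vertices"
    using nbr_vertices[OF a(1)] by auto
  define D where "D = d w v"
  have D: "1 \<le> D"
    unfolding D_def using d_vertices_ge_1 w v wv by blast
  have q: "c t \<in> M"
    using in_underlying l by blast
  have wl: "w \<in> cell_of l" "pd l (c t) w = t"
    using geodesic_near_vertex[OF w v c wv _ t(2) l] t by auto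
  obtain k x i where x: "k \<in> Cubes K" "x \<in> vert k" "i < cdim K k" "w = chart K k x"
    "a = chart K k (flip i x)"
    using a(1) unfolding nbr_def by blast
  \<comment> \<open>Any positive \<open>s\<close> with \<open>2 * s < 1 - t\<^sup>2\<close> serves:
    it means \<open>t\<^sup>2 + s\<^sup>2 < (1 - s)\<^sup>2\<close>, which keeps the distance to
    \<open>y\<close> below the cutoff \<open>1 - s\<close>.\<close>
  define s where "s = (1 - t\<^sup>2) / 4"
  have t2: "0 < t\<^sup>2" "t\<^sup>2 < 1"
    using t by (auto simp: power_less_one_iff)
  have s4: "4 * s = 1 - t\<^sup>2"
    by (simp add: s_def)
  with t2 have s: "0 < s" "s < 1"
    by linarith+
  define y where "y = chart K k (edge_point i s x)"
  have e: "on_edge k w a s y"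
    unfolding on_edge_def y_def using x by blast
  have yM: "y \<in> M"
    unfolding y_def using edge_point_cube[OF x(2,3)] s x(1) in_underlying by simp
  have g: "geodesic M d a w (\<lambda>r. chart K k (edge_point i (1 - r) x))"
    unfolding x(4,5) using geodesic_edge x by blast
  have le: "(d (c t) y)\<^sup>2 \<le> t\<^sup>2 + s\<^sup>2 - t * s / D"
    using CAT0_hinge[OF _ _ _ _ g c d_nbr[OF a(1)] D_def[symmetric] D, of t s] a(2) t s D cat0
      vertices_underlying w av v
    by (simp add: CAT0_complex_def y_def D_def)
  have pos: "0 < t * s / D"
    using t s D by simp
  have "t\<^sup>2 + s\<^sup>2 < (1 - s)\<^sup>2"
  proof -
    have "(1 - s)\<^sup>2 = 1 - 2 * s + s\<^sup>2"
      by (simp add: power2_eq_square algebra_simps)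
    then show ?thesis
      using s4 t2 by linarith
  qed
  then have "(d (c t) y)\<^sup>2 < (1 - s)\<^sup>2"
    using le pos by linarith
  then have "d (c t) y < 1 - s"
    using s by (intro power2_less_imp_less[of _ "1 - s"]) auto
  moreover have "(d (c t) y)\<^sup>2 < (pd l (c t) w)\<^sup>2 + s\<^sup>2"
    using le pos unfolding wl(2) by linarith
  ultimately have y: "y \<in> cell_of l" "pd l (c t) y \<le> d (c t) y"
    using edge_point_lower_bound[OF e s finite_edist[OF q yM] l wl(1)] by auto
  obtain x' i' where x': "x' \<in> vert l" "i' < cdim K l" "w = chart K l x'" "a = chart K l (flip i' x')"
    "y = chart K l (edge_point i' s x')"
    using on_edge_transfer[OF e l(1) y(1) s] unfolding on_edge_def by blast
  have fx: "flip i' x' \<in> vert l"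
    using x' flip_vertex by blast
  then show "a \<in> cell_of l"
    using x' vert_cube by blast
  let ?u = "coord l (c t)"
  \<comment> \<open>Stewart's theorem converts the bound at \<open>y\<close> into one at the far end
    \<open>a\<close>; after cancelling, a factor \<open>s\<close> can be divided out.\<close>
  have "(ed l ?u (edge_point i' s x'))\<^sup>2 = (1 - s) * (ed l ?u x')\<^sup>2 + s * (ed l ?u (flip i' x'))\<^sup>2
      - s * (1 - s) * (ed l x' (flip i' x'))\<^sup>2"
    by (rule stewart) (rule edge_point_convex)
  moreover have "ed l ?u (edge_point i' s x') = pd l (c t) y" "ed l ?u x' = t"
    "ed l ?u (flip i' x') = pd l (c t) a"
    using wl(2) l(1) edge_point_cube[OF x'(1,2), of s] s vert_cube[OF x'(1)] vert_cube[OF fx]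
    by (simp_all add: pd_def x'(3-5))
  ultimately have "(pd l (c t) y)\<^sup>2 = (1 - s) * t\<^sup>2 + s * (pd l (c t) a)\<^sup>2 - s * (1 - s)"
    using eucl_dist_flip[OF x'(1,2)] by simp
  moreover have "(pd l (c t) y)\<^sup>2 \<le> (d (c t) y)\<^sup>2"
    using y(2) by (intro power_mono) auto
  ultimately have "s * (pd l (c t) a)\<^sup>2 \<le> s * (t\<^sup>2 + 1 - t / D)"
    using le by (simp add: power2_eq_square algebra_simps)
  then show "(pd l (c t) a)\<^sup>2 \<le> t\<^sup>2 + 1 - t / d w v"
    using s by (simp add: D_def)
qed

text \<open>The cube is any one containing a point \<open>q\<close> of the geodesic at a time
  \<open>t\<close> just below 1. A corner nearer to \<open>q\<close> than \<open>w\<close> is nearer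
  to \<open>v\<close> as well, so the claims reduce to comparing distances from \<open>q\<close>
  inside this cube.\<close>

lemma descending_cube:
  assumes w: "w \<in> vertices" and v: "v \<in> vertices" and wv: "w \<noteq> v"
  obtains l x where "l \<in> Cubes K" "x \<in> vert l" "w = chart K l x"
    "\<forall>a. nbr w a \<and> d a v \<le> d w v \<longrightarrow> a \<in> cell_of l"
    "\<exists>i<cdim K l. d (chart K l (flip i x)) v < d w v"
    "cdim K l = 2 \<and> d (chart K l (flip 0 x)) v \<le> d w v \<and> d (chart K l (flip 1 x)) v \<le> d w v
      \<longrightarrow> d (chart K l (flip 0 (flip 1 x))) v < d w v"
proof -
  define D where "D = d w v"
  have D: "1 \<le> D"
    unfolding D_def using d_vertices_ge_1 w v wv by blast
  have wM: "w \<in> M" and vM: "v \<in> M"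
    using w v vertices_underlying by auto
  obtain c where c: "geodesic M d w v c"
    using ex_geodesic[OF wM vM] .
  \<comment> \<open>If both coordinate offsets \<open>r 0\<close> and \<open>r 1\<close> are at
    least \<open>t / (2 * D)\<close>, then
    \<open>(r 0 + r 1)\<^sup>2 = t\<^sup>2 + 2 * r 0 * r 1\<close> is at least
    \<open>t\<^sup>2 * B\<close>.\<close>
  define B where "B = 1 + 1 / (2 * D\<^sup>2)"
  have B: "1 < B"
    using D by (simp add: B_def)
  \<comment> \<open>The bound \<open>3/4\<close> ensures \<open>t\<^sup>2 > 1/2\<close>, for the
    strictly lower neighbour; the other ensures \<open>t\<^sup>2 * B > 1\<close>, for the opposite
    corner.\<close>
  have "max (3/4) (sqrt (1 / B)) < 1"
    using B by simp
  then obtain t where t: "max (3/4) (sqrt (1 / B)) < t" "t < 1"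
    using dense by blast
  then have t34: "3/4 < t" and "sqrt (1 / B) < t"
    by auto
  then have "1 / B < t\<^sup>2"
    using real_less_lsqrt by (metis B le_less_trans less_eq_real_def not_le real_le_rsqrt zero_less_divide_1_iff)
  then have tB: "1 < t\<^sup>2 * B"
    using B by (simp add: field_simps)
  define q where "q = c t"
  have ct: "q \<in> M" "d q v = D - t"
  proof -
    have *: "t \<in> {0..d w v}" "d w v \<in> {0..d w v}"
      using t34 t D by (auto simp: D_def)
    then show "q \<in> M"
      using c unfolding geodesic_def q_def by blast
    have "d (c t) (c (d w v)) = \<bar>t - d w v\<bar>" "c (d w v) = v"
      using c * unfolding geodesic_def by blast+
    then show "d q v = D - t"
      using * by (simp add: q_def D_def)
  qed
  obtain l where l: "l \<in> Cubes K" "q \<in> cell_of l"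
    using underlyingE[OF ct(1)] .
  have wl: "w \<in> cell_of l" "pd l q w = t"
    using geodesic_near_vertex[OF w v c wv _ t(2) l[unfolded q_def]] t34 by (auto simp: q_def)
  define x where "x = coord l w"
  define u where "u = coord l q"
  have x: "x \<in> vert l" "w = chart K l x"
    unfolding x_def using coord_vertex coord(2) w l wl by auto
  have u: "u \<in> unit_cube (cdim K l)"
    unfolding u_def using coord(1)[OF l(2)] by (simp add: cube_of_def)
  have ux: "ed l u x = t"
    using wl(2) by (simp add: pd_def u_def x_def)
  have sum: "(\<Sum>i<cdim K l. (u i - x i)\<^sup>2) = t\<^sup>2"
    using ux by (simp flip: eucl_dist_power2)
  \<comment> \<open>Since \<open>q\<close> is on the geodesic, \<open>d q v = D - t\<close>, and the
    triangle inequality through \<open>q\<close> suffices.\<close>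
  have lower: "d (chart K l z) v < D" if "z \<in> vert l" "(ed l u z)\<^sup>2 < t\<^sup>2" for z
  proof -
    have z: "chart K l z \<in> cell_of l" "z \<in> cube_of K l"
      using that vert_cube by auto
    have "ed l u z < t"
      using that(2) t34 by (intro power2_less_imp_less[of _ t]) auto
    moreover have "d (chart K l z) q \<le> pd l (chart K l z) q"
      using l z by (intro length_dist_le_pd) auto
    moreover have "\<dots> = ed l u z"
      using l z by (simp add: pd_def u_def eucl_dist_commute)
    ultimately show ?thesis
      using d_triangle[of "chart K l z" q v] in_underlying[OF l(1) z(1)] ct vM by simp
  qed
  have flip_d: "(ed l u (flip i z))\<^sup>2 = (ed l u z)\<^sup>2 + 1 - 2 * \<bar>u i - z i\<bar>"
    if "i < cdim K l" "z \<in> vert l" for i z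
    using eucl_dist_flip_sq[OF that(2) u that(1)] .
  show ?thesis
  proof (rule that[OF l(1) x])
    show "\<forall>a. nbr w a \<and> d a v \<le> d w v \<longrightarrow> a \<in> cell_of l"
      using descending_nbr[OF v c wv _ t(2) l[unfolded q_def]] t34 by simp
    show "\<exists>i<cdim K l. d (chart K l (flip i x)) v < d w v"
    proof -
      \<comment> \<open>At most two coordinates with offsets at most \<open>1/2\<close> would give
        \<open>t\<^sup>2 \<le> 1/2\<close>.\<close>
      have "\<exists>i<cdim K l. 1/2 < \<bar>u i - x i\<bar>"
      proof (rule ccontr)
        assume "\<not> ?thesis"
        then have "(u i - x i)\<^sup>2 \<le> (1/2)\<^sup>2" if "i < cdim K l" for i
          using that by (intro abs_le_square_iff[THEN iffD1]) auto
        then have "(\<Sum>i<cdim K l. (u i - x i)\<^sup>2) \<le> of_nat (card {..<cdim K l}) * (1/2)\<^sup>2"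
          by (intro sum_bounded_above) auto
        also have "\<dots> \<le> 2 * (1/2)\<^sup>2"
          using cdim_le_2[OF l(1)] by (intro mult_right_mono) auto
        finally have "t\<^sup>2 \<le> 1/2"
          using sum by (simp add: power2_eq_square)
        moreover have "(3/4)\<^sup>2 \<le> t\<^sup>2"
          using t34 by (intro power_mono) auto
        ultimately show False
          by (simp add: power2_eq_square)
      qed
      then obtain i where i: "i < cdim K l" "1/2 < \<bar>u i - x i\<bar>"
        by blast
      then have "(ed l u (flip i x))\<^sup>2 < t\<^sup>2"
        using flip_d[OF i(1) x(1)] ux by simp
      then show ?thesis
        using lower[OF flip_vertex[OF x(1) i(1)]] i(1) by (auto simp: D_def)
    qed
    show "cdim K l = 2 \<and> d (chart K l (flip 0 x)) v \<le> d w v \<and> d (chart K l (flip 1 x)) v \<le> d w v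
      \<longrightarrow> d (chart K l (flip 0 (flip 1 x))) v < d w v"
    proof (intro impI, elim conjE)
      assume n: "cdim K l = 2" and 0: "d (chart K l (flip 0 x)) v \<le> d w v"
        and 1: "d (chart K l (flip 1 x)) v \<le> d w v"
      define r where "r i = \<bar>u i - x i\<bar>" for i
      \<comment> \<open>This is the quantitative form of the acute angle, read off by comparing
        \<open>descending_nbr\<close> with the formula for a flip.\<close>
      have r: "t / (2 * D) \<le> r i" if i: "i < cdim K l" "d (chart K l (flip i x)) v \<le> d w v" for i
      proof -
        have "nbr w (chart K l (flip i x))"
          unfolding nbr_def using l x i by blast
        then have "(pd l q (chart K l (flip i x)))\<^sup>2 \<le> t\<^sup>2 + 1 - t / D"
          using descending_nbr(2)[OF v c wv _ t(2) l[unfolded q_def] _ i(2)] t34 by (simp add: q_def D_def)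
        moreover have "pd l q (chart K l (flip i x)) = ed l u (flip i x)"
          using l vert_cube[OF flip_vertex[OF x(1) i(1)]] by (simp add: pd_def u_def)
        ultimately have "2 * r i \<ge> t / D"
          using flip_d[OF i(1) x(1)] ux by (simp add: r_def)
        then show ?thesis
          using D by (simp add: field_simps)
      qed
      have r01: "t / (2 * D) \<le> r 0" "t / (2 * D) \<le> r 1"
        using r n 0 1 by auto
      have nonneg: "0 \<le> t / (2 * D)"
        using t34 D by simp
      have "(r 0)\<^sup>2 + (r 1)\<^sup>2 = t\<^sup>2"
        using sum n by (simp add: numeral_2_eq_2 r_def)
      moreover have "(t / (2 * D)) * (t / (2 * D)) \<le> r 0 * r 1"
        using r01 nonneg by (intro mult_mono) auto
      moreover have "2 * ((t / (2 * D)) * (t / (2 * D))) = t\<^sup>2 * (B - 1)"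
        using D by (simp add: B_def power2_eq_square)
      ultimately have "t\<^sup>2 * B \<le> (r 0 + r 1)\<^sup>2"
        by (simp add: power2_eq_square algebra_simps)
      then have "1\<^sup>2 < (r 0 + r 1)\<^sup>2"
        using tB by simp
      then have r1: "1 < r 0 + r 1"
        using r01 nonneg by (intro power2_less_imp_less[of 1 "r 0 + r 1"]) auto
      \<comment> \<open>Two flips change the squared distance by \<open>2 - 2 * (r 0 + r 1)\<close>,
        which is negative.\<close>
      have "(ed l u (flip 0 (flip 1 x)))\<^sup>2 = t\<^sup>2 + 2 - 2 * (r 0 + r 1)"
        using flip_d[of 0 "flip 1 x"] flip_d[of 1 x] x(1) flip_vertex[OF x(1), of 1] n ux
        by (simp add: r_def flip_apply)
      then show "d (chart K l (flip 0 (flip 1 x))) v < d w v"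
        using lower[of "flip 0 (flip 1 x)"] flip_vertex x(1) n r1 by (simp add: D_def)
    qed
  qed
qed

section \<open>Balls contain finitely many vertices\<close>

lemma cell_of_cell: "l \<in> Cubes K \<Longrightarrow> cell_of l \<in> cells K"
proof -
  assume l: "l \<in> Cubes K"
  have "is_cell K (cdim K l) (cell_of l)"
    unfolding is_cell_iff
  proof (intro bexI exI conjI)
    show "cell_of l = chart K l ` sub l {..<cdim K l} (\<lambda>_. 0)"
      by (auto simp: subface_def cube_of_def unit_cubeD(3))
  qed (use l in \<open>auto simp: cube_vertices_def\<close>)
  then show ?thesis
    by (auto simp: cells_def)
qed

lemma finite_cells_at:
  assumes "p \<in> M"
  shows "finite {\<alpha> \<in> cells K. p \<in> \<alpha>}"
proof -
  obtain r where r: "0 < r" "finite {\<alpha> \<in> cells K. \<alpha> \<inter> {y \<in> M. length_edist K p y < ereal r} \<noteq> {}}"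
    using lf assms unfolding locally_finite_complex_def by blast
  have "length_edist K p p \<le> ereal 0"
    unfolding length_edist_def using polygonal_path.point[OF assms] by (intro INF_lower) auto
  also have "\<dots> < ereal r"
    using r by simp
  finally have "{\<alpha> \<in> cells K. p \<in> \<alpha>} \<subseteq> {\<alpha> \<in> cells K. \<alpha> \<inter> {y \<in> M. length_edist K p y < ereal r} \<noteq> {}}"
    using assms by blast
  then show ?thesis
    using r finite_subset by blast
qed

lemma finite_cell_vertices:
  assumes "\<alpha> \<in> cells K"
  shows "finite (\<alpha> \<inter> vertices)"
proof -
  obtain l x J where l: "l \<in> Cubes K" "\<alpha> = chart K l ` sub l J x"
    using assms unfolding cells_def is_cell_iff by blast
  have "\<alpha> \<inter> vertices \<subseteq> chart K l ` vert l"
  proof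
    fix w assume "w \<in> \<alpha> \<inter> vertices"
    then obtain z where "z \<in> cube_of K l" "w = chart K l z" "w \<in> vertices"
      using l by (auto simp: subface_def cube_of_def)
    then show "w \<in> chart K l ` vert l"
      using vertex_coord[OF _ l(1)] by blast
  qed
  then show ?thesis
    using finite_cube_vertices finite_subset by blast
qed

text \<open>Rounding every coordinate gives a corner at distance at most \<open>sqrt (1/2)\<close>.
  The number \<open>18/25\<close> lies just above this and leaves room for a step of
  \<open>1/4\<close> below 1.\<close>

lemma near_vertex:
  assumes "l \<in> Cubes K" "p \<in> cell_of l"
  obtains u where "u \<in> vertices" "u \<in> cell_of l" "pd l p u < 18/25"
proof -
  define z where "z = coord l p"
  define x where "x i = (if 1/2 \<le> z i then 1 else 0 :: real)" for i
  have z: "z \<in> unit_cube (cdim K l)"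
    unfolding z_def using coord(1)[OF assms(2)] by (simp add: cube_of_def)
  have x: "x \<in> vert l"
    using unit_cubeD(3)[OF z] by (auto simp: cube_vertices_def x_def)
  have "(z i - x i)\<^sup>2 \<le> (1/2)\<^sup>2" for i
    using unit_cubeD(1,2)[OF z, of i] by (intro abs_le_square_iff[THEN iffD1]) (auto simp: x_def)
  then have "(\<Sum>i<cdim K l. (z i - x i)\<^sup>2) \<le> of_nat (card {..<cdim K l}) * (1/2)\<^sup>2"
    by (intro sum_bounded_above) auto
  also have "\<dots> \<le> 2 * (1/2)\<^sup>2"
    using cdim_le_2[OF assms(1)] by (intro mult_right_mono) auto
  finally have "(ed l z x)\<^sup>2 < (18/25)\<^sup>2"
    unfolding eucl_dist_power2 by (simp add: power2_eq_square)
  then have "ed l z x < 18/25"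
    by (rule power2_less_imp_less) simp
  then show ?thesis
    using x assms vert_cube[OF x]
    by (intro that[of "chart K l x"]) (auto simp: vertices_iff pd_def z_def)
qed

text \<open>Combinatorial balls, where one step joins any two vertices of a common cell, diagonals
  included. Local finiteness makes them finite.\<close>

primrec reach :: "'a \<Rightarrow> nat \<Rightarrow> 'a set" where
  "reach v 0 = {v}"
| "reach v (Suc k) = reach v k \<union> (\<Union>u\<in>reach v k. \<Union>\<alpha>\<in>{\<alpha> \<in> cells K. u \<in> \<alpha>}. \<alpha> \<inter> vertices)"

lemma reach_finite:
  assumes "v \<in> vertices"
  shows "finite (reach v k) \<and> reach v k \<subseteq> vertices"
  using assms
proof (induction k)
  case (Suc k)
  then have IH: "finite (reach v k)" "reach v k \<subseteq> vertices"
    by auto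
  have "finite (\<Union>\<alpha>\<in>{\<alpha> \<in> cells K. u \<in> \<alpha>}. \<alpha> \<inter> vertices)" if "u \<in> reach v k" for u
  proof (rule finite_UN_I)
    show "finite {\<alpha> \<in> cells K. u \<in> \<alpha>}"
      using that IH(2) vertices_underlying by (intro finite_cells_at) blast
  qed (simp add: finite_cell_vertices)
  then have "finite (reach v (Suc k))"
    unfolding reach.simps by (intro finite_UnI finite_UN_I[OF IH(1)] IH(1))
  moreover have "reach v (Suc k) \<subseteq> vertices"
    unfolding reach.simps using IH(2) by blast
  ultimately show ?case
    by blast
qed simp

text \<open>Every point is within \<open>18/25\<close> of a vertex of its cube, and a step of length \<open>1/4\<close> cannot
  leave the open star of that vertex.\<close>

lemma near_reach:
  assumes v: "v \<in> vertices"
  shows "p \<in> M \<Longrightarrow> d v p \<le> real k / 4 \<Longrightarrow>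
    \<exists>u\<in>reach v k. \<exists>l\<in>Cubes K. p \<in> cell_of l \<and> u \<in> cell_of l \<and> pd l p u < 18/25"
proof (induction k arbitrary: p)
  case 0
  then have "p = v"
    using Metric_space.zero[OF metric vertices_underlying[OF v], of p] d_nonneg[of v p] by auto
  moreover obtain l where "l \<in> Cubes K" "p \<in> cell_of l"
    using underlyingE[OF 0(1)] .
  ultimately show ?case
    by (intro bexI[of _ v] bexI[of _ l]) simp_all
next
  case (Suc k)
  have vM: "v \<in> M"
    using v vertices_underlying by blast
  show ?case
  proof (cases "d v p \<le> real k / 4")
    case True
    then obtain u l where "u \<in> reach v k" "l \<in> Cubes K" "p \<in> cell_of l" "u \<in> cell_of l" "pd l p u < 18/25"
      using Suc(1)[OF Suc(2)] by blast
    then show ?thesis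
      by (intro bexI[of _ u] bexI[of _ l]) simp_all
  next
    case False
    obtain c where c: "geodesic M d v p c"
      using ex_geodesic[OF vM Suc(2)] .
    \<comment> \<open>Cut the geodesic at \<open>k / 4\<close>: the induction hypothesis applies at
      the cut, and the remaining piece has length at most \<open>1/4\<close>.\<close>
    define r where "r = real k / 4"
    have r: "0 \<le> r" "r \<le> d v p" "d v p \<le> r + 1/4"
      using False Suc(3) by (auto simp: r_def field_simps)
    then have rD: "0 \<in> {0..d v p}" "r \<in> {0..d v p}" "d v p \<in> {0..d v p}"
      by auto
    have "c r \<in> M"
      using c rD(2) unfolding geodesic_def by blast
    have "d (c 0) (c r) = \<bar>0 - r\<bar>" "d (c r) (c (d v p)) = \<bar>r - d v p\<bar>" "c 0 = v" "c (d v p) = p"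
      using c rD unfolding geodesic_def by blast+
    then have cr: "d v (c r) \<le> real k / 4" "d (c r) p \<le> 1/4"
      using r by (auto simp: r_def)
    obtain u l where u: "u \<in> reach v k" "l \<in> Cubes K" "c r \<in> cell_of l" "u \<in> cell_of l" "pd l (c r) u < 18/25"
      using Suc(1)[OF \<open>c r \<in> M\<close> cr(1)] by blast
    obtain m where m: "m \<in> Cubes K" "p \<in> cell_of m"
      using underlyingE[OF Suc(2)] .
    \<comment> \<open>Here \<open>18/25 + 1/4 < 1\<close> is used: the vertex \<open>u\<close> near
      \<open>c r\<close> also lies in the cube of \<open>p\<close>.\<close>
    have "u \<in> cell_of m"
      using vertex_lower_bound[of u p "c r" l m] u m cr finite_edist[OF Suc(2) \<open>c r \<in> M\<close>] reach_finite[OF v, of k]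
      by (auto simp: d_commute[of p])
    moreover obtain u' where u': "u' \<in> vertices" "u' \<in> cell_of m" "pd m p u' < 18/25"
      using near_vertex[OF m] .
    ultimately have "u' \<in> reach v (Suc k)"
      using u(1) cell_of_cell[OF m(1)] by (simp only: reach.simps) blast
    then show ?thesis
      using u' m by blast
  qed
qed

lemma finite_ball_vertices:
  assumes v: "v \<in> vertices"
  shows "finite {w \<in> vertices. d w v \<le> R}"
proof -
  obtain k where k: "4 * R \<le> real k"
    using real_arch_simple by blast
  \<comment> \<open>The extra step is needed because \<open>near_reach\<close> yields a vertex in a
    common cube with \<open>w\<close>, not \<open>w\<close> itself.\<close>
  have "{w \<in> vertices. d w v \<le> R} \<subseteq> reach v (Suc k)"
  proof clarify
    fix w assume w: "w \<in> vertices" "d w v \<le> R"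
    then have "d v w \<le> real k / 4"
      using k d_commute[of v w] by simp
    then obtain u l where "u \<in> reach v k" "l \<in> Cubes K" "w \<in> cell_of l" "u \<in> cell_of l"
      using near_reach[OF v vertices_underlying[OF w(1)]] by blast
    then show "w \<in> reach v (Suc k)"
      using w(1) cell_of_cell by (simp only: reach.simps) blast
  qed
  then show ?thesis
    using reach_finite[OF v] finite_subset by blast
qed

section \<open>Collapsing\<close>

definition full :: "'a set \<Rightarrow> 'a set set" where
  "full A = {\<alpha> \<in> cells K. \<alpha> \<inter> vertices \<subseteq> A}"

lemma cell_face_subset: "cell_face K \<beta> \<alpha> \<Longrightarrow> \<beta> \<in> cells K \<and> \<beta> \<subseteq> \<alpha>"
  unfolding cell_face_def cells_def is_cell_def by blast

lemma full_subcomplex: "subcomplex K (full A)"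
  unfolding subcomplex_def full_def using cell_face_subset by blast

lemma is_cell_sub:
  "l \<in> Cubes K \<Longrightarrow> x \<in> vert l \<Longrightarrow> J \<subseteq> {..<cdim K l} \<Longrightarrow> is_cell K (card J) (chart K l ` sub l J x)"
  unfolding is_cell_iff by blast

lemma cell_face_sub:
  assumes "l \<in> Cubes K" "x \<in> vert l" "I \<subseteq> J" "J \<subseteq> {..<cdim K l}"
  shows "cell_face K (chart K l ` sub l I x) (chart K l ` sub l J x)"
  unfolding cell_face_def
proof (intro bexI exI conjI)
  show "cube_face (cdim K l) (card I) (sub l I x)" "cube_face (cdim K l) (card J) (sub l J x)"
    using assms by (auto intro!: cube_face_subface)
  show "sub l I x \<subseteq> sub l J x"
    using assms(3) by (auto simp: subface_def)
qed (use assms in auto)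

text \<open>The corner \<open>flip i x\<close> belongs to a face through \<open>x\<close> exactly
  when \<open>i\<close> is one of its directions. So inclusion of cells at a vertex is inclusion of
  index sets.\<close>

lemma sub_mono_iff:
  assumes l: "l \<in> Cubes K" and x: "x \<in> vert l" and I: "I \<subseteq> {..<cdim K l}"
  shows "chart K l ` sub l I x \<subseteq> chart K l ` sub l J x \<longleftrightarrow> I \<subseteq> J"
proof
  assume sub: "chart K l ` sub l I x \<subseteq> chart K l ` sub l J x"
  show "I \<subseteq> J"
  proof
    fix i assume i: "i \<in> I"
    then have fx: "flip i x \<in> vert l"
      using flip_vertex x I by blast
    have "flip i x \<in> sub l I x"
      using i fx cube_vertices_subset by (auto simp: subface_def flip_apply)
    then obtain z where "z \<in> sub l J x" "chart K l (flip i x) = chart K l z"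
      using sub by blast
    then have "flip i x \<in> sub l J x"
      using chart_inj[OF l vert_cube[OF fx], of z] by (auto simp: subface_def cube_of_def)
    moreover have "flip i x i \<noteq> x i"
      using cube_vertex_cases[OF x, of i] by (auto simp: flip_apply)
    ultimately show "i \<in> J"
      by (auto simp: subface_def)
  qed
qed (auto simp: subface_def)

text \<open>By maximality of \<open>w\<close>, its neighbours in \<open>A\<close> all lie in the
  cube \<open>l\<close>, so the cells at \<open>w\<close> are the faces \<open>\<Phi> J\<close> for
  \<open>J \<subseteq> N\<close>, where \<open>N\<close> has one or two elements. These sets are
  removed in pairs: \<open>{i}\<close> with \<open>{}\<close>, or \<open>{i, j}\<close> with
  \<open>{i}\<close> and then \<open>{j}\<close> with \<open>{}\<close>.\<close>

lemma collapse_vertex: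
  assumes v: "v \<in> vertices" and A: "A \<subseteq> vertices" "w \<in> A" "w \<noteq> v"
    and max: "\<forall>a\<in>A. d a v \<le> d w v"
    and down: "\<forall>a\<in>A. \<forall>b\<in>vertices. d b v < d a v \<longrightarrow> b \<in> A"
  shows "(elementary_collapse K)\<^sup>*\<^sup>* (full A) (full (A - {w}))"
proof -
  have w: "w \<in> vertices"
    using A by blast
  obtain l x where l: "l \<in> Cubes K" and x: "x \<in> vert l" "w = chart K l x"
    and in_l: "\<forall>a. nbr w a \<and> d a v \<le> d w v \<longrightarrow> a \<in> cell_of l"
    and ex: "\<exists>i<cdim K l. d (chart K l (flip i x)) v < d w v"
    and opp: "cdim K l = 2 \<and> d (chart K l (flip 0 x)) v \<le> d w v \<and> d (chart K l (flip 1 x)) v \<le> d w v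
      \<longrightarrow> d (chart K l (flip 0 (flip 1 x))) v < d w v"
    by (rule descending_cube[OF w v A(3)])
  let ?n = "cdim K l"
  define \<Phi> where "\<Phi> J = chart K l ` sub l J x" for J
  define N where "N = {i. i < ?n \<and> chart K l (flip i x) \<in> A}"
  have N: "N \<subseteq> {..<?n}"
    by (auto simp: N_def)
  have flip_vertices: "chart K l (flip i x) \<in> vertices" if "i < ?n" for i
    using that l x flip_vertex vertices_iff by blast
  have "N \<noteq> {}"
    using ex down A(2) flip_vertices by (auto simp: N_def)
  have \<Phi>_le: "\<Phi> I \<subseteq> \<Phi> J \<longleftrightarrow> I \<subseteq> J" if "I \<subseteq> N" for I J
    unfolding \<Phi>_def using sub_mono_iff[OF l x(1)] that N by blast
  have \<Phi>_eq: "\<Phi> I = \<Phi> J \<longleftrightarrow> I = J" if "I \<subseteq> N" "J \<subseteq> N" for I J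
    using \<Phi>_le that by blast
  have w_in: "w \<in> \<Phi> J" for J
    unfolding \<Phi>_def x(2) using x(1) cube_vertices_subset by (auto simp: subface_def)
  have at_w: "\<exists>J\<subseteq>N. \<gamma> = \<Phi> J" if \<gamma>: "\<gamma> \<in> full A" "w \<in> \<gamma>" for \<gamma>
  proof -
    have "a \<in> cell_of l" if "a \<in> \<gamma>" "nbr (chart K l x) a" for a
      using in_l max that \<gamma>(1) nbr_vertices(2)[OF that(2)] x(2) by (auto simp: full_def)
    then obtain J where J: "J \<subseteq> {..<?n}" "\<gamma> = chart K l ` sub l J x"
      using face_transfer[OF l x(1), of \<gamma>] \<gamma> x(2) by (auto simp: full_def)
    have "J \<subseteq> N"
    proof
      fix i assume i: "i \<in> J"
      then have "flip i x \<in> sub l J x"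
        using J(1) flip_vertex[OF x(1)] cube_vertices_subset by (auto simp: subface_def flip_apply)
      then show "i \<in> N"
        using \<gamma>(1) i J flip_vertices[of i] by (auto simp: full_def N_def)
    qed
    then show ?thesis
      using J(2) by (auto simp: \<Phi>_def)
  qed
  have n2: "?n \<le> 2"
    using cdim_le_2[OF l] .
  \<comment> \<open>Only the corner that differs from \<open>x\<close> in both directions needs
    geometry: it is strictly nearer to \<open>v\<close>, so \<open>down\<close> puts it into
    \<open>A\<close>.\<close>
  have \<Phi>_full: "\<Phi> J \<in> full A" if J: "J \<subseteq> N" for J
  proof -
    have "b \<in> A" if b: "b \<in> \<Phi> J" "b \<in> vertices" for b
    proof -
      obtain z where z: "z \<in> sub l J x" "b = chart K l z"
        using b(1) by (auto simp: \<Phi>_def)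
      then have zv: "z \<in> vert l"
        using vertex_coord[OF b(2) l] by (auto simp: subface_def cube_of_def)
      have out: "z i = x i" if "i \<notin> J" for i
        using z(1) that by (simp add: subface_def)
      define I where "I = {i. z i \<noteq> x i}"
      have "I \<subseteq> J"
        using out by (auto simp: I_def)
      then have IN: "I \<subseteq> N"
        using J by blast
      have z_eq: "z i = (if i \<in> I then 1 - x i else x i)" for i
        using cube_vertex_cases[OF zv, of i] cube_vertex_cases[OF x(1), of i] by (auto simp: I_def)
      have "I \<subseteq> {0, 1}"
        using IN N n2 by auto
      then consider "I = {}" | i where "I = {i}" | "I = {0, 1}"
        by (metis subset_insert_iff subset_singleton_iff insert_Diff)
      then show ?thesis
      proof cases
        case 1
        then have "z = x"
          using z_eq by auto
        then show ?thesis
          using z(2) x(2) A(2) by simp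
      next
        case (2 i)
        then have "z = flip i x"
          using z_eq by (auto simp: flip_apply)
        then show ?thesis
          using z(2) IN 2 by (auto simp: N_def)
      next
        case 3
        then have "z = flip 0 (flip 1 x)"
          using z_eq by (auto simp: flip_apply)
        moreover have "?n = 2" "chart K l (flip 0 x) \<in> A" "chart K l (flip 1 x) \<in> A"
          using IN 3 N n2 by (auto simp: N_def)
        ultimately have "d b v < d w v"
          using opp max z(2) by simp
        then show ?thesis
          using down A(2) b(2) by blast
      qed
    qed
    moreover have "\<Phi> J \<in> cells K"
      unfolding \<Phi>_def cells_def using is_cell_sub[OF l x(1)] J N by blast
    ultimately show ?thesis
      by (auto simp: full_def)
  qed
  have removed: "full (A - {w}) = full A - \<Phi> ` Pow N"
  proof (intro set_eqI iffI)
    fix \<gamma> assume "\<gamma> \<in> full (A - {w})"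
    then show "\<gamma> \<in> full A - \<Phi> ` Pow N"
      using w_in w by (auto simp: full_def)
  next
    fix \<gamma> assume "\<gamma> \<in> full A - \<Phi> ` Pow N"
    then show "\<gamma> \<in> full (A - {w})"
      using at_w[of \<gamma>] by (auto simp: full_def)
  qed
  \<comment> \<open>A cell containing \<open>\<Phi> I\<close> contains \<open>w\<close> and is some
    \<open>\<Phi> J'\<close>, so freeness is a condition on index sets alone.\<close>
  have collapse: "elementary_collapse K L (L - {\<Phi> J, \<Phi> I})"
    if L: "subcomplex K L" "L \<subseteq> full A" and IJ: "I \<subset> J" "J \<subseteq> N" "\<Phi> I \<in> L" "\<Phi> J \<in> L"
      and free: "\<And>J'. J' \<subseteq> N \<Longrightarrow> I \<subseteq> J' \<Longrightarrow> \<Phi> J' \<in> L \<Longrightarrow> J' = I \<or> J' = J" for L I J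
    unfolding elementary_collapse_def
  proof (intro conjI bexI exI)
    show "is_cell K (card J) (\<Phi> J)" "is_cell K (card I) (\<Phi> I)"
      unfolding \<Phi>_def using is_cell_sub[OF l x(1)] IJ N by auto
    show "card I < card J"
      using IJ(1) finite_subset[OF subset_trans[OF IJ(2) N]] by (intro psubset_card_mono) auto
    show "cell_face K (\<Phi> I) (\<Phi> J)"
      unfolding \<Phi>_def using IJ N by (intro cell_face_sub[OF l x(1)]) auto
    show "\<forall>\<gamma>\<in>L. cell_face K (\<Phi> I) \<gamma> \<and> \<gamma> \<noteq> \<Phi> I \<longrightarrow> \<gamma> = \<Phi> J"
    proof (intro ballI impI, elim conjE)
      fix \<gamma> assume \<gamma>: "\<gamma> \<in> L" "cell_face K (\<Phi> I) \<gamma>" "\<gamma> \<noteq> \<Phi> I"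
      then have sub: "\<Phi> I \<subseteq> \<gamma>"
        using cell_face_subset by blast
      then obtain J' where J': "J' \<subseteq> N" "\<gamma> = \<Phi> J'"
        using at_w \<gamma>(1) L(2) w_in[of I] by blast
      then have "I \<subseteq> J'"
        using sub \<Phi>_le IJ by blast
      then show "\<gamma> = \<Phi> J"
        using free J' \<gamma> by blast
    qed
  qed (use L IJ in auto)
  obtain i where i: "i \<in> N"
    using \<open>N \<noteq> {}\<close> by blast
  show ?thesis
  proof (cases "N = {i}")
    case True
    have "elementary_collapse K (full A) (full A - {\<Phi> {i}, \<Phi> {}})"
      using True \<Phi>_full full_subcomplex by (intro collapse) auto
    moreover have "full A - {\<Phi> {i}, \<Phi> {}} = full (A - {w})"
      unfolding removed True by (auto simp: Pow_insert)
    ultimately show ?thesis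
      by auto
  next
    case False
    then obtain j where j: "j \<in> N" "j \<noteq> i"
      using i by blast
    have N2: "k < 2" if "k \<in> N" for k
      using that N n2 by auto
    have "k = i \<or> k = j" if "k \<in> N" for k
      using N2[OF that] N2[OF i] N2[OF j(1)] j(2) by linarith
    then have Nij: "N = {i, j}"
      using i j(1) by blast
    define L where "L = full A - {\<Phi> {i, j}, \<Phi> {i}}"
    have 1: "elementary_collapse K (full A) L"
      unfolding L_def using Nij j \<Phi>_full full_subcomplex by (intro collapse) auto
    have "subcomplex K L"
      unfolding subcomplex_def
    proof (intro conjI ballI allI impI)
      show "L \<subseteq> cells K"
        by (auto simp: L_def full_def)
      fix \<alpha> \<beta> assume \<alpha>: "\<alpha> \<in> L" "cell_face K \<beta> \<alpha>"
      then have "\<beta> \<in> full A"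
        using full_subcomplex by (auto simp: subcomplex_def L_def)
      \<comment> \<open>Only \<open>{i}\<close> and \<open>{i, j}\<close> index cells containing
        this edge, and both are gone; so no remaining cell lacks a face.\<close>
      moreover have "\<not> \<Phi> {i} \<subseteq> \<alpha>"
      proof
        assume sub: "\<Phi> {i} \<subseteq> \<alpha>"
        then obtain J where J: "J \<subseteq> N" "\<alpha> = \<Phi> J"
          using at_w \<alpha>(1) w_in[of "{i}"] by (auto simp: L_def)
        then have "i \<in> J"
          using sub \<Phi>_le[of "{i}" J] i by simp
        then have "J = {i} \<or> J = {i, j}"
          using J(1) Nij by blast
        then show False
          using \<alpha>(1) J(2) by (auto simp: L_def)
      qed
      then have "\<beta> \<noteq> \<Phi> {i}" "\<beta> \<noteq> \<Phi> {i, j}"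
        using cell_face_subset[OF \<alpha>(2)] \<Phi>_le[of "{i}" "{i, j}"] i by auto
      ultimately show "\<beta> \<in> L"
        by (auto simp: L_def)
    qed
    moreover have "\<Phi> {} \<in> L" "\<Phi> {j} \<in> L"
      using \<Phi>_full Nij j(2) by (auto simp: L_def \<Phi>_eq)
    moreover have "J' = {} \<or> J' = {j}" if "J' \<subseteq> N" "\<Phi> J' \<in> L" for J'
    proof -
      have "J' \<noteq> {i}" "J' \<noteq> {i, j}"
        using that(2) by (auto simp: L_def)
      then show ?thesis
        using that(1) Nij by blast
    qed
    ultimately have 2: "elementary_collapse K L (L - {\<Phi> {j}, \<Phi> {}})"
      using Nij by (intro collapse) (auto simp: L_def)
    have "L - {\<Phi> {j}, \<Phi> {}} = full (A - {w})"
      unfolding removed Nij L_def by (auto simp: Pow_insert insert_commute)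
    then show ?thesis
      using 1 2 by (metis r_into_rtranclp rtranclp.rtrancl_into_rtrancl)
  qed
qed

text \<open>Induction on the number of vertices, removing a farthest one. Since it is a maximum, no
  remaining vertex requires it in \<open>down\<close>, and the hypothesis persists.\<close>

lemma collapse_full:
  assumes v: "v \<in> vertices" and "finite A" "A \<subseteq> vertices" "v \<in> A"
    and down: "\<forall>a\<in>A. \<forall>b\<in>vertices. d b v < d a v \<longrightarrow> b \<in> A"
  shows "(elementary_collapse K)\<^sup>*\<^sup>* (full A) {{v}}"
  using assms(2-)
proof (induction "card A" arbitrary: A rule: less_induct)
  case less
  show ?case
  proof (cases "A = {v}")
    case True
    have "full A = {{v}}"
    proof (intro set_eqI iffI)
      fix \<alpha> assume \<alpha>: "\<alpha> \<in> full A"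
      then obtain l x J where l: "l \<in> Cubes K" "x \<in> vert l" "J \<subseteq> {..<cdim K l}" "\<alpha> = chart K l ` sub l J x"
        unfolding full_def cells_def is_cell_iff by blast
      have in_v: "chart K l z = v" if "z \<in> vert l" "z \<in> sub l J x" for z
      proof -
        have "chart K l z \<in> vertices"
          unfolding vertices_iff using l(1) that(1) by blast
        then show ?thesis
          using \<alpha> l(4) that True by (auto simp: full_def)
      qed
      have xJ: "x \<in> sub l J x"
        using l(2) cube_vertices_subset by (auto simp: subface_def)
      have "J = {}"
      proof (rule equals0I)
        fix i assume i: "i \<in> J"
        then have fx: "flip i x \<in> vert l"
          using flip_vertex l by blast
        then have "flip i x \<in> sub l J x"
          using i cube_vertices_subset by (auto simp: subface_def flip_apply)
        then have "chart K l (flip i x) = chart K l x"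
          using in_v fx xJ l(2) by simp
        then show False
          using chart_inj[OF l(1) vert_cube[OF fx] vert_cube[OF l(2)]] flip_neq[OF l(2)] by simp
      qed
      then show "\<alpha> \<in> {{v}}"
        using l in_v[OF l(2) xJ] by (simp add: subface_0)
    next
      fix \<alpha> assume "\<alpha> \<in> {{v}}"
      then show "\<alpha> \<in> full A"
        using v True by (auto simp: full_def vertices_def cells_def)
    qed
    then show ?thesis
      by simp
  next
    case False
    define m where "m = Max ((\<lambda>a. d a v) ` A)"
    have "m \<in> (\<lambda>a. d a v) ` A"
      unfolding m_def using less.prems by (intro Max_in) auto
    then obtain w where w: "w \<in> A" "m = d w v"
      by blast
    have max: "\<forall>a\<in>A. d a v \<le> d w v"
      using less.prems(1) w(2) unfolding m_def by (metis Max_ge finite_imageI imageI)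
    obtain a where a: "a \<in> A" "a \<noteq> v"
      using False less.prems(3) by blast
    \<comment> \<open>Another vertex has positive distance from \<open>v\<close>, so a farthest
      vertex is not \<open>v\<close>.\<close>
    then have "0 < d a v"
      using d_vertices_ge_1[of a v] less.prems(2) v by force
    then have wv: "w \<noteq> v"
      using max a(1) d_self[OF vertices_underlying[OF v]] by force
    have "(elementary_collapse K)\<^sup>*\<^sup>* (full A) (full (A - {w}))"
      using collapse_vertex[OF v less.prems(2) w(1) wv max less.prems(4)] .
    moreover have "(elementary_collapse K)\<^sup>*\<^sup>* (full (A - {w})) {{v}}"
    proof (rule less.hyps)
      show "card (A - {w}) < card A"
        using less.prems(1) w(1) by (intro psubset_card_mono) auto
      show "\<forall>a\<in>A - {w}. \<forall>b\<in>vertices. d b v < d a v \<longrightarrow> b \<in> A - {w}"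
        using less.prems(4) max by force
    qed (use less.prems wv in auto)
    ultimately show ?thesis
      by (rule rtranclp_trans)
  qed
qed

lemma ex_arborescent_structure: "\<exists>L. arborescent_structure K L"
proof -
  obtain l where l: "l \<in> Cubes K"
    using dim unfolding complex_dim_def is_cell_def by blast
  define v where "v = chart K l (\<lambda>_. 0)"
  have v: "v \<in> vertices"
    unfolding vertices_iff v_def using l by (intro bexI[of _ l] bexI[of _ "\<lambda>_. 0"]) (auto simp: cube_vertices_def)
  define A where "A n = {w \<in> vertices. d w v \<le> real n}" for n
  have "arborescent_structure K (\<lambda>n. full (A n))"
    unfolding arborescent_structure_def
  proof (intro conjI allI impI)
    fix n
    show "subcomplex K (full (A n))"
      by (rule full_subcomplex)
    have "(elementary_collapse K)\<^sup>*\<^sup>* (full (A n)) {{v}}"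
    proof (rule collapse_full[OF v])
      show "finite (A n)"
        unfolding A_def using finite_ball_vertices[OF v] .
    qed (use v d_self[OF vertices_underlying[OF v]] in \<open>auto simp: A_def\<close>)
    then show "collapsible K (full (A n))"
      unfolding collapsible_def using full_subcomplex v by (auto simp: vertices_def)
    show "full (A n) \<subseteq> full (A (Suc n))"
      by (auto simp: full_def A_def)
  next
    show "cells K = (\<Union>n\<in>{1..}. full (A n))"
    proof (intro set_eqI iffI)
      fix \<alpha> assume \<alpha>: "\<alpha> \<in> cells K"
      \<comment> \<open>A crude bound for the distances of the finitely many vertices of the cell.
        The union starts at index 1, so \<open>Suc n\<close> is used below.\<close>
      define R where "R = (\<Sum>w\<in>\<alpha> \<inter> vertices. d w v)"
      obtain n where n: "R \<le> real n"
        using real_arch_simple by blast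
      have "d w v \<le> real (Suc n)" if "w \<in> \<alpha> \<inter> vertices" for w
      proof -
        have "d w v \<le> R"
          unfolding R_def using that finite_cell_vertices[OF \<alpha>] d_nonneg by (intro member_le_sum) auto
        then show ?thesis
          using n by simp
      qed
      then have "\<alpha> \<in> full (A (Suc n))"
        using \<alpha> by (auto simp: full_def A_def)
      then show "\<alpha> \<in> (\<Union>n\<in>{1..}. full (A n))"
        by (intro UN_I[of "Suc n"]) auto
    qed (auto simp: full_def)
  qed
  then show ?thesis
    by blast
qed

end

theorem corollary3p13:
  fixes K :: "('i, 'a) cubes"
  assumes "square_complex K"
    and "locally_finite_complex K"
    and "CAT0_complex K"
  shows "\<exists>L. arborescent_structure K L"
proof -
  interpret cat0_square K
    using assms by unfold_locales (auto simp: square_complex_def)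
  show ?thesis
    by (rule ex_arborescent_structure)
qed

end
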